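(* Suppose that $\boldsymbol{w}=(w_1,\dots,w_p)'$ has i.i.d. positive entries with $\mathbb{E}w_1=\mu>0$, $\mathbb{E}(w_1-\mu)^2=\sigma^2$ and $\mathbb{E}|w_1-\mu|^4<\infty$, and let $\boldsymbol{r}=\frac{1}{\sqrt n}\bigl(\frac{w_1}{\overline w}-1,\dots,\frac{w_p}{\overline w}-1\bigr)'$. Let $\boldsymbol{A}=(A_{ij})$ and $\boldsymbol{B}=(B_{ij})$ be (nonrandom) $p\times p$ matrices with $\|\boldsymbol{A}\|\le K$ and $\|\boldsymbol{B}\|\le K$ for a constant $K$. Then, as $n\to\infty$, $$\begin{aligned} &\mathbb{E}\Bigl(\boldsymbol{r}'\boldsymbol{A}\boldsymbol{r}-\frac1n\nu_2\mathrm{tr}\boldsymbol{A}\Bigr)\Bigl(\boldsymbol{r}'\boldsymbol{B}\boldsymbol{r}-\frac1n\nu_2\mathrm{tr}\boldsymbol{B}\Bigr)\\ &\quad=\frac{1}{n^2}(\nu_4-3\nu_{12})\sum_{i=1}^pA_{ii}B_{ii}+\frac1{n^2}\nu_{12}\bigl(\mathrm{tr}(\boldsymbol{A}\boldsymbol{B}')+\mathrm{tr}(\boldsymbol{A}\boldsymbol{B})\bigr)+\frac{1}{n^2}(\nu_{12}-\nu_2^2)\,\mathrm{tr}\boldsymbol{A}\,\mathrm{tr}\boldsymbol{B}+o(n^{-1}). \end{aligned}$$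
   Context: $\overline w=\frac1p\sum_{j=1}^pw_j$, $\nu_2=\mathbb{E}(\frac{w_1}{\overline w}-1)^2$, $\nu_4=\mathbb{E}(\frac{w_1}{\overline w}-1)^4$, $\nu_{12}=\mathbb{E}(\frac{w_1}{\overline w}-1)^2(\frac{w_2}{\overline w}-1)^2$. $\|\cdot\|$ is the spectral norm and $'$ denotes transpose. Standing: $p=p(n)$ with $p/n\to c\in(0,\infty)$ as $n\to\infty$. *)

theory Defs
  imports "HOL-Probability.Probability" "Jordan_Normal_Form.Matrix"
begin

definition mat_tr :: "'a::comm_monoid_add mat \<Rightarrow> 'a" where
  "mat_tr A = (\<Sum>i<dim_row A. A $$ (i, i))"

definition euclid_norm :: "complex vec \<Rightarrow> real" where
  "euclid_norm v = sqrt (\<Sum>i<dim_vec v. (cmod (v $ i))\<^sup>2)"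

(* The set is bounded above, so Sup on the reals is not a junk value. Using the closed unit ball
   (not the unit sphere) keeps the set nonempty for a matrix without columns. *)
definition spectral_norm :: "complex mat \<Rightarrow> real" where
  "spectral_norm A = Sup {euclid_norm (A *\<^sub>v v) | v. v \<in> carrier_vec (dim_col A) \<and> euclid_norm v \<le> 1}"

(* All indices start at 0: the entries w_1, ..., w_p are w 0, ..., w (p - 1). *)

definition wbar :: "(nat \<Rightarrow> 'a \<Rightarrow> real) \<Rightarrow> nat \<Rightarrow> 'a \<Rightarrow> real" where
  "wbar w p x = (\<Sum>j<p. w j x) / real p"

definition wdev :: "(nat \<Rightarrow> 'a \<Rightarrow> real) \<Rightarrow> nat \<Rightarrow> nat \<Rightarrow> 'a \<Rightarrow> real" where
  "wdev w p i x = w i x / wbar w p x - 1"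

(* For i < p and positive w one has -1 < wdev w p i \<le> p - 1, so the expectations below are
   those of bounded random variables (for \<nu>12 as soon as p \<ge> 2). *)

definition \<nu>2 :: "'a measure \<Rightarrow> (nat \<Rightarrow> 'a \<Rightarrow> real) \<Rightarrow> nat \<Rightarrow> real" where
  "\<nu>2 M w p = (\<integral>x. (wdev w p 0 x)\<^sup>2 \<partial>M)"

definition \<nu>4 :: "'a measure \<Rightarrow> (nat \<Rightarrow> 'a \<Rightarrow> real) \<Rightarrow> nat \<Rightarrow> real" where
  "\<nu>4 M w p = (\<integral>x. (wdev w p 0 x) ^ 4 \<partial>M)"

definition \<nu>12 :: "'a measure \<Rightarrow> (nat \<Rightarrow> 'a \<Rightarrow> real) \<Rightarrow> nat \<Rightarrow> real" where
  "\<nu>12 M w p = (\<integral>x. (wdev w p 0 x)\<^sup>2 * (wdev w p 1 x)\<^sup>2 \<partial>M)"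

(* The vector r; it is real, but typed as complex since the matrices are complex. *)
definition rvec :: "(nat \<Rightarrow> 'a \<Rightarrow> real) \<Rightarrow> nat \<Rightarrow> nat \<Rightarrow> 'a \<Rightarrow> complex vec" where
  "rvec w n p x = vec p (\<lambda>i. complex_of_real (wdev w p i x / sqrt (real n)))"

(* v'Av with the plain transpose: scalar_prod is bilinear, nothing is conjugated. *)
definition quad_form :: "complex mat \<Rightarrow> complex vec \<Rightarrow> complex" where
  "quad_form A v = scalar_prod v (A *\<^sub>v v)"

end

theory Submission
  imports Defs "HOL-Real_Asymp.Real_Asymp"
begin

text \<open>The deviations \<^term>\<open>wdev w p i\<close> are exchangeable and sum to zero. Exchangeability leaves only a
handful of distinct moments of order two and four, and summing one index out expresses those in which
some index occurs exactly once through \<open>\<nu>2\<close>, \<open>\<nu>4\<close>, \<open>\<nu>12\<close> with a gain of a factor \<open>1/p\<close> each time. Expanding the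
covariance of the two quadratic forms in this moment tensor, everything apart from the asserted main
terms is \<open>O(\<nu>4 / n\<^sup>2)\<close>, by the bounds that the spectral norm puts on the diagonal, the row and column sums
and the Frobenius norm, except for the terms pairing a trace with a sum of all entries: these have
size \<open>p\<^sup>2\<close>, but their coefficients combine to \<open>(\<nu>2\<^sup>2 - \<nu>12) / p\<close> up to \<open>O(\<nu>4 / p\<^sup>2)\<close>. It remains to see that \<open>\<nu>4\<close> stays bounded and
\<open>\<nu>12 - \<nu>2\<^sup>2\<close> tends to zero. The latter difference is the variance of the mean of the squared deviations, up
to \<open>O(\<nu>4 / p)\<close>. Both facts are immediate where \<^term>\<open>wbar w p x > \<mu> / 2\<close>; the complement has
exponentially small probability because the weights are positive.\<close>

section \<open>Sums of products and matrices with bounded spectral norm\<close>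

lemma extend_to_bij_lessThan:
  fixes ys :: "nat list"
  assumes "distinct ys" "set ys \<subseteq> {..<p}"
  obtains \<pi> where "bij_betw \<pi> {..<p} {..<p}" "\<And>i. i < length ys \<Longrightarrow> \<pi> i = ys ! i"
proof -
  have le: "length ys \<le> p"
    using assms card_mono[of "{..<p}" "set ys"] by (simp add: distinct_card)
  have "card {length ys..<p} = card ({..<p} - set ys)"
    using assms by (simp add: card_Diff_subset distinct_card)
  then obtain h where h: "bij_betw h {length ys..<p} ({..<p} - set ys)"
    using finite_same_card_bij[of "{length ys..<p}" "{..<p} - set ys"] by auto
  define \<pi> where "\<pi> i = (if i < length ys then ys ! i else h i)" for i
  have "bij_betw \<pi> {..<length ys} (set ys)"
    using bij_betw_nth[OF assms(1) refl refl] by (subst bij_betw_cong[where g = "(!) ys"]) (auto simp: \<pi>_def)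
  moreover have "bij_betw \<pi> {length ys..<p} ({..<p} - set ys)"
    using h by (subst bij_betw_cong[where g = h]) (auto simp: \<pi>_def)
  ultimately have "bij_betw \<pi> ({..<length ys} \<union> {length ys..<p}) (set ys \<union> ({..<p} - set ys))"
    by (rule bij_betw_combine) auto
  moreover have "{..<length ys} \<union> {length ys..<p} = {..<p}" "set ys \<union> ({..<p} - set ys) = {..<p}"
    using le assms(2) by auto
  ultimately show thesis
    by (intro that[of \<pi>]) (auto simp: \<pi>_def)
qed

text \<open>As a rewrite rule this moves a Kronecker delta out of sums over indices it does not
  mention, until it meets the sum that it collapses.\<close>

lemma sum_if_const: "(\<Sum>i\<in>S. if P then f i else 0) = (if P then \<Sum>i\<in>S. f i else 0)"
  by simp

text \<open>Both factors obey the same bound \<open>b\<close>, so the arithmetic-geometric mean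
  inequality in each term replaces Cauchy-Schwarz.\<close>

lemma norm_sum_mult_le:
  fixes x y :: "'i \<Rightarrow> complex"
  assumes "(\<Sum>i\<in>S. (cmod (x i))\<^sup>2) \<le> b" "(\<Sum>i\<in>S. (cmod (y i))\<^sup>2) \<le> b"
  shows "cmod (\<Sum>i\<in>S. x i * y i) \<le> b"
proof -
  have "cmod (x i * y i) \<le> ((cmod (x i))\<^sup>2 + (cmod (y i))\<^sup>2) / 2" for i
    using sum_squares_bound[of "cmod (x i)" "cmod (y i)"] by (simp add: norm_mult)
  then have "cmod (\<Sum>i\<in>S. x i * y i) \<le> (\<Sum>i\<in>S. ((cmod (x i))\<^sup>2 + (cmod (y i))\<^sup>2) / 2)"
    by (intro sum_norm_le)
  also have "\<dots> = ((\<Sum>i\<in>S. (cmod (x i))\<^sup>2) + (\<Sum>i\<in>S. (cmod (y i))\<^sup>2)) / 2"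
    by (simp add: sum.distrib flip: sum_divide_distrib)
  finally show ?thesis using assms by simp
qed

lemma norm_sum_square_le:
  fixes x :: "nat \<Rightarrow> complex"
  shows "(cmod (\<Sum>i<p. x i))\<^sup>2 \<le> real p * (\<Sum>i<p. (cmod (x i))\<^sup>2)"
proof -
  have "(cmod (\<Sum>i<p. x i))\<^sup>2 \<le> (\<Sum>i<p. cmod (x i))\<^sup>2"
    by (intro power_mono sum_norm_le) auto
  also have "\<dots> \<le> real p * (\<Sum>i<p. (cmod (x i))\<^sup>2)"
    using Cauchy_Schwarz_ineq_sum[of "\<lambda>_. 1" "\<lambda>i. cmod (x i)" "{..<p}"] by simp
  finally show ?thesis .
qed

lemma norm_sum_le_of_sum_squares:
  fixes x :: "nat \<Rightarrow> complex"
  assumes "(\<Sum>i<p. (cmod (x i))\<^sup>2) \<le> K\<^sup>2 * real p" "0 \<le> K"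
  shows "cmod (\<Sum>i<p. x i) \<le> K * real p"
proof -
  have "(cmod (\<Sum>i<p. x i))\<^sup>2 \<le> real p * (K\<^sup>2 * real p)"
    using assms by (intro order_trans[OF norm_sum_square_le] mult_left_mono) auto
  also have "\<dots> = (K * real p)\<^sup>2"
    by (simp only: power2_eq_square mult_ac)
  finally show ?thesis
    using assms(2) by (auto intro: power2_le_imp_le)
qed

text \<open>All that the argument needs to know about a matrix of spectral norm at most \<open>K\<close>.\<close>

definition l2_bounded :: "real \<Rightarrow> nat \<Rightarrow> (nat \<Rightarrow> nat \<Rightarrow> complex) \<Rightarrow> bool" where
  "l2_bounded K p A \<longleftrightarrow>
     (\<Sum>i<p. \<Sum>j<p. (cmod (A i j))\<^sup>2) \<le> K\<^sup>2 * real p \<and>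
     (\<Sum>i<p. (cmod (\<Sum>j<p. A i j))\<^sup>2) \<le> K\<^sup>2 * real p \<and>
     (\<Sum>j<p. (cmod (\<Sum>i<p. A i j))\<^sup>2) \<le> K\<^sup>2 * real p"

lemma l2_bounded_diagonal:
  assumes "l2_bounded K p A"
  shows "(\<Sum>i<p. (cmod (A i i))\<^sup>2) \<le> K\<^sup>2 * real p"
proof -
  have "(\<Sum>i<p. (cmod (A i i))\<^sup>2) \<le> (\<Sum>i<p. \<Sum>j<p. (cmod (A i j))\<^sup>2)"
    by (intro sum_mono member_le_sum[where f = "\<lambda>j. (cmod (A _ j))\<^sup>2"]) auto
  then show ?thesis
    using assms by (simp add: l2_bounded_def)
qed

text \<open>These sums are \<open>tr(A B')\<close> and \<open>tr(A B)\<close>. A matrix is read as a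
  vector indexed by pairs; transposing \<open>B\<close> leaves its Frobenius norm unchanged.\<close>

lemma norm_sum_mult_entries_le:
  assumes "l2_bounded K p A" "l2_bounded K p B"
  shows "cmod (\<Sum>i<p. \<Sum>j<p. A i j * B i j) \<le> K\<^sup>2 * real p"
    and "cmod (\<Sum>i<p. \<Sum>j<p. A i j * B j i) \<le> K\<^sup>2 * real p"
proof -
  have "(\<Sum>(i, j)\<in>{..<p} \<times> {..<p}. (cmod (A i j))\<^sup>2) \<le> K\<^sup>2 * real p"
    "(\<Sum>(i, j)\<in>{..<p} \<times> {..<p}. (cmod (B i j))\<^sup>2) \<le> K\<^sup>2 * real p"
    using assms by (simp_all add: l2_bounded_def sum.cartesian_product)
  moreover have "(\<Sum>(i, j)\<in>{..<p} \<times> {..<p}. (cmod (B j i))\<^sup>2) \<le> K\<^sup>2 * real p"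
    using assms(2) by (subst sum.cartesian_product[symmetric], subst sum.swap) (simp add: l2_bounded_def)
  ultimately show "cmod (\<Sum>i<p. \<Sum>j<p. A i j * B i j) \<le> K\<^sup>2 * real p"
    "cmod (\<Sum>i<p. \<Sum>j<p. A i j * B j i) \<le> K\<^sup>2 * real p"
    using norm_sum_mult_le[of "case_prod A" "{..<p} \<times> {..<p}" _ "case_prod B"]
      norm_sum_mult_le[of "case_prod A" "{..<p} \<times> {..<p}" _ "\<lambda>(i, j). B j i"]
    by (simp_all add: sum.cartesian_product case_prod_unfold)
qed

section \<open>From the spectral norm to l2 bounds on entries, row sums and column sums\<close>

lemma euclid_norm_eq: "euclid_norm (vec p v) = L2_set (\<lambda>i. cmod (v i)) {..<p}"
  by (simp add: euclid_norm_def L2_set_def)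

lemma mult_mat_vec_eq:
  assumes "A \<in> carrier_mat p p"
  shows "A *\<^sub>v vec p v = vec p (\<lambda>i. \<Sum>j<p. A $$ (i, j) * v j)"
  using assms by (auto simp: vec_eq_iff scalar_prod_def lessThan_atLeast0 intro!: sum.cong)

text \<open>Without boundedness the \<open>Sup\<close> in \<open>spectral_norm\<close> would say
  nothing. Entries of a vector in the unit ball have modulus at most 1, so the sum of the moduli of
  all entries of \<open>A\<close> is a crude upper bound.\<close>

lemma bdd_above_spectral_norm:
  assumes "A \<in> carrier_mat p p"
  shows "bdd_above {euclid_norm (A *\<^sub>v v) | v. v \<in> carrier_vec (dim_col A) \<and> euclid_norm v \<le> 1}"
proof (rule bdd_aboveI)
  fix r assume "r \<in> {euclid_norm (A *\<^sub>v v) | v. v \<in> carrier_vec (dim_col A) \<and> euclid_norm v \<le> 1}"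
  then obtain v' where v': "v' \<in> carrier_vec p" "euclid_norm v' \<le> 1" "r = euclid_norm (A *\<^sub>v v')"
    using assms by auto
  define v where "v = vec_index v'"
  have v: "v' = vec p v"
    using v'(1) by (auto simp: v_def)
  have "cmod (v j) \<le> 1" if "j < p" for j
    using that v'(2) member_le_L2_set[of "{..<p}" j "\<lambda>i. cmod (v i)"]
    by (simp add: v euclid_norm_eq)
  then have "cmod (\<Sum>j<p. A $$ (i, j) * v j) \<le> (\<Sum>j<p. cmod (A $$ (i, j)))" for i
    by (intro sum_norm_le) (simp add: norm_mult mult_left_le)
  then have "(\<Sum>i<p. cmod (\<Sum>j<p. A $$ (i, j) * v j)) \<le> (\<Sum>i<p. \<Sum>j<p. cmod (A $$ (i, j)))"
    by (intro sum_mono)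
  moreover have "r \<le> (\<Sum>i<p. cmod (\<Sum>j<p. A $$ (i, j) * v j))"
    unfolding v'(3) v mult_mat_vec_eq[OF assms] euclid_norm_eq by (intro L2_set_le_sum) simp
  ultimately show "r \<le> (\<Sum>i<p. \<Sum>j<p. cmod (A $$ (i, j)))"
    by simp
qed

text \<open>The supremum covers only the unit ball; homogeneity extends it by dividing
  \<open>v\<close> by its norm \<open>N\<close>. If \<open>N = 0\<close>, all entries of
  \<open>v\<close> vanish and both sides are 0.\<close>

lemma L2_set_mult_le_spectral_norm:
  fixes v :: "nat \<Rightarrow> complex"
  assumes A: "A \<in> carrier_mat p p"
  shows "L2_set (\<lambda>i. cmod (\<Sum>j<p. A $$ (i, j) * v j)) {..<p} \<le> spectral_norm A * L2_set (\<lambda>j. cmod (v j)) {..<p}"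
proof -
  have unit: "L2_set (\<lambda>i. cmod (\<Sum>j<p. A $$ (i, j) * u j)) {..<p} \<le> spectral_norm A"
    if "L2_set (\<lambda>j. cmod (u j)) {..<p} \<le> 1" for u
    unfolding spectral_norm_def
  proof (rule cSup_upper[OF _ bdd_above_spectral_norm[OF A]], intro CollectI exI conjI)
    show "L2_set (\<lambda>i. cmod (\<Sum>j<p. A $$ (i, j) * u j)) {..<p} = euclid_norm (A *\<^sub>v vec p u)"
      by (simp add: mult_mat_vec_eq[OF A] euclid_norm_eq)
  qed (use A that in \<open>auto simp: euclid_norm_eq\<close>)
  define N where "N = L2_set (\<lambda>j. cmod (v j)) {..<p}"
  show ?thesis
  proof (cases "N = 0")
    case True
    then have "v j = 0" if "j < p" for j
      using that by (auto simp: N_def L2_set_eq_0_iff)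
    then have "L2_set (\<lambda>i. cmod (\<Sum>j<p. A $$ (i, j) * v j)) {..<p} = 0"
      by (simp add: L2_set_eq_0_iff)
    with True show ?thesis
      by (simp add: N_def)
  next
    case False
    then have N: "N > 0"
      by (simp add: N_def order_less_le L2_set_nonneg)
    have scale: "L2_set (\<lambda>i. cmod (f i / of_real N)) {..<p} = L2_set (\<lambda>i. cmod (f i)) {..<p} / N" for f
      using L2_set_left_distrib[of "1 / N" "\<lambda>i. cmod (f i)" "{..<p}"] N by (simp add: norm_divide)
    have "L2_set (\<lambda>i. cmod ((\<Sum>j<p. A $$ (i, j) * v j) / of_real N)) {..<p} \<le> spectral_norm A"
      using unit[of "\<lambda>j. v j / of_real N"] N unfolding scale N_def[symmetric]
      by (simp add: scale flip: sum_divide_distrib)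
    then show ?thesis
      using N unfolding scale by (simp add: pos_divide_le_eq flip: N_def)
  qed
qed

lemma sum_square_mult_le:
  assumes "A \<in> carrier_mat p p" "spectral_norm A \<le> K"
  shows "(\<Sum>i<p. (cmod (\<Sum>j<p. A $$ (i, j) * v j))\<^sup>2) \<le> K\<^sup>2 * (\<Sum>j<p. (cmod (v j))\<^sup>2)"
proof -
  have "L2_set (\<lambda>i. cmod (\<Sum>j<p. A $$ (i, j) * v j)) {..<p} \<le> K * L2_set (\<lambda>j. cmod (v j)) {..<p}"
    using assms by (intro order_trans[OF L2_set_mult_le_spectral_norm] mult_right_mono L2_set_nonneg)
  then have "(L2_set (\<lambda>i. cmod (\<Sum>j<p. A $$ (i, j) * v j)) {..<p})\<^sup>2 \<le> (K * L2_set (\<lambda>j. cmod (v j)) {..<p})\<^sup>2"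
    by (intro power_mono L2_set_nonneg)
  then show ?thesis
    by (simp add: power_mult_distrib L2_set_def sum_nonneg)
qed

text \<open>The zero vector lies in the unit ball. This supplies the \<open>0 \<le> K\<close> that
  the covariance bound asks for.\<close>

lemma spectral_norm_nonneg:
  assumes "A \<in> carrier_mat p p"
  shows "0 \<le> spectral_norm A"
proof -
  have "L2_set (\<lambda>i. cmod (\<Sum>j<p. A $$ (i, j) * 0)) {..<p} \<le> spectral_norm A"
    unfolding spectral_norm_def
    by (rule cSup_upper[OF _ bdd_above_spectral_norm[OF assms]])
       (use assms in \<open>auto simp: mult_mat_vec_eq euclid_norm_eq L2_set_def intro!: exI[of _ "vec p (\<lambda>_. 0)"]\<close>)
  then show ?thesis
    by (simp add: L2_set_def)
qed

text \<open>Three kinds of test vectors: the unit vectors bound each column, hence the Frobenius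
  norm; the all-ones vector bounds the row sums; the conjugated column sums bound themselves, which
  avoids passing to the adjoint.\<close>

lemma l2_bounded_spectral_norm:
  assumes A: "A \<in> carrier_mat p p" "spectral_norm A \<le> K"
  shows "l2_bounded K p (\<lambda>i j. A $$ (i, j))"
proof -
  note le = sum_square_mult_le[OF A]
  have "(\<Sum>i<p. (cmod (A $$ (i, k)))\<^sup>2) \<le> K\<^sup>2" if "k < p" for k
    using le[of "\<lambda>j. if j = k then 1 else 0"] that
    by (simp add: mult_delta_right if_distrib[of "\<lambda>x. (cmod x)\<^sup>2"] cong: if_cong)
  then have "(\<Sum>k<p. \<Sum>i<p. (cmod (A $$ (i, k)))\<^sup>2) \<le> (\<Sum>k<p. K\<^sup>2)"
    by (intro sum_mono) auto
  then have "(\<Sum>i<p. \<Sum>j<p. (cmod (A $$ (i, j)))\<^sup>2) \<le> K\<^sup>2 * real p"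
    by (subst sum.swap) (simp add: mult.commute)
  moreover have "(\<Sum>i<p. (cmod (\<Sum>j<p. A $$ (i, j)))\<^sup>2) \<le> K\<^sup>2 * real p"
    using le[of "\<lambda>_. 1"] by simp
  moreover have "(\<Sum>j<p. (cmod (\<Sum>i<p. A $$ (i, j)))\<^sup>2) \<le> K\<^sup>2 * real p"
  proof -
    \<comment> \<open>Test against the conjugated column sums: \<open>S\<close> is then the sum of the entries of the image.\<close>
    define c where "c j = (\<Sum>i<p. A $$ (i, j))" for j
    define y where "y i = (\<Sum>j<p. A $$ (i, j) * cnj (c j))" for i
    define S where "S = (\<Sum>j<p. (cmod (c j))\<^sup>2)"
    have "complex_of_real S = (\<Sum>j<p. c j * cnj (c j))"
      by (simp add: S_def complex_norm_square del: of_real_power)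
    also have "\<dots> = (\<Sum>j<p. \<Sum>i<p. A $$ (i, j) * cnj (c j))"
      by (simp only: c_def sum_distrib_right)
    also have "\<dots> = (\<Sum>i<p. y i)"
      unfolding y_def by (rule sum.swap)
    finally have "S\<^sup>2 = (cmod (\<Sum>i<p. y i))\<^sup>2"
      by (metis norm_of_real power2_abs)
    also have "\<dots> \<le> real p * (\<Sum>i<p. (cmod (y i))\<^sup>2)"
      by (rule norm_sum_square_le)
    also have "\<dots> \<le> real p * (K\<^sup>2 * S)"
      using le[of "\<lambda>j. cnj (c j)"] by (intro mult_left_mono) (auto simp: y_def S_def)
    finally have "S * S \<le> S * (K\<^sup>2 * real p)"
      by (simp add: power2_eq_square mult_ac)
    moreover have "0 \<le> S"
      by (simp add: S_def sum_nonneg)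
    ultimately have "S \<le> K\<^sup>2 * real p"
      by (cases "S = 0") (auto simp: mult_le_cancel_left)
    then show ?thesis
      by (simp add: S_def c_def)
  qed
  ultimately show ?thesis
    by (simp add: l2_bounded_def)
qed

section \<open>Exchangeable vectors with zero sum\<close>

text \<open>Exchangeability is demanded only for expectations of products. Index lists may repeat
  entries, so all mixed powers are covered. The bound \<open>C\<close> serves integrability; the
  moment estimates below are in terms of \<open>m4\<close> instead.\<close>

locale exchangeable_zero_sum = prob_space M for M :: "'a measure" +
  fixes d :: "nat \<Rightarrow> 'a \<Rightarrow> real" and p :: nat and C :: real
  assumes measurable_d [measurable]: "\<And>i. d i \<in> borel_measurable M"
    and bounded: "\<And>i. i < p \<Longrightarrow> AE x in M. \<bar>d i x\<bar> \<le> C"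
    and zero_sum: "AE x in M. (\<Sum>i<p. d i x) = 0"
    and exchangeable: "\<And>\<pi> xs. bij_betw \<pi> {..<p} {..<p} \<Longrightarrow> set xs \<subseteq> {..<p} \<Longrightarrow>
      expectation (\<lambda>x. \<Prod>i\<leftarrow>map \<pi> xs. d i x) = expectation (\<lambda>x. \<Prod>i\<leftarrow>xs. d i x)"
begin

text \<open>In the list the multiplicity of an index is its exponent. Reordering factors and
  relabelling indices thus become list operations.\<close>

definition mom :: "nat list \<Rightarrow> real" where
  "mom xs = expectation (\<lambda>x. \<Prod>i\<leftarrow>xs. d i x)"

lemma integrable_prod_list:
  assumes "set xs \<subseteq> {..<p}"
  shows "integrable M (\<lambda>x. \<Prod>i\<leftarrow>xs. d i x)"
proof (rule integrable_const_bound[where B = "C ^ length xs"])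
  have "AE x in M. \<forall>i<p. \<bar>d i x\<bar> \<le> C"
    using bounded AE_ball_countable[of "{..<p}" "\<lambda>x i. \<bar>d i x\<bar> \<le> C" M] by auto
  then show "AE x in M. norm (\<Prod>i\<leftarrow>xs. d i x) \<le> C ^ length xs"
  proof eventually_elim
    case (elim x)
    show ?case
      using assms
    proof (induction xs)
      case (Cons a xs)
      then show ?case
        using elim by (auto simp: abs_mult intro!: mult_mono order_trans[OF abs_ge_zero])
    qed simp
  qed
next
  show "(\<lambda>x. \<Prod>i\<leftarrow>xs. d i x) \<in> borel_measurable M"
    by (induction xs) auto
qed

lemma mom_perm: "mset xs = mset ys \<Longrightarrow> mom xs = mom ys"
  unfolding mom_def by (metis (no_types) mset_map prod_mset_prod_list)

text \<open>Here \<open>xs\<close> is a coincidence pattern such as \<open>[0, 0, 1, 1]\<close>, and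
  \<open>ys\<close> lists the distinct indices put in its places. A moment depends only on its
  pattern, since some permutation carries \<open>0, 1, ...\<close> to \<open>ys\<close>.\<close>

lemma mom_nth:
  assumes "distinct ys" "set ys \<subseteq> {..<p}" "set xs \<subseteq> {..<length ys}"
  shows "mom (map ((!) ys) xs) = mom xs"
proof -
  obtain \<pi> where \<pi>: "bij_betw \<pi> {..<p} {..<p}" "\<And>i. i < length ys \<Longrightarrow> \<pi> i = ys ! i"
    using extend_to_bij_lessThan assms by metis
  have "map ((!) ys) xs = map \<pi> xs"
    using assms(3) \<pi>(2) by auto
  moreover have "length ys \<le> p"
    using assms card_mono[of "{..<p}" "set ys"] by (simp add: distinct_card)
  then have "set xs \<subseteq> {..<p}"
    using assms(3) by auto
  ultimately show ?thesis
    using exchangeable[OF \<pi>(1)] by (simp only: mom_def)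
qed

text \<open>Pulling the remaining product out leaves the factor \<open>\<Sum>i<p. d i x\<close>,
  which vanishes almost everywhere. All linear relations between moments come from here.\<close>

lemma mom_zero_sum:
  assumes "set xs \<subseteq> {..<p}"
  shows "(\<Sum>i<p. mom (i # xs)) = 0"
proof -
  have "(\<Sum>i<p. mom (i # xs)) = expectation (\<lambda>x. \<Sum>i<p. \<Prod>j\<leftarrow>i # xs. d j x)"
    unfolding mom_def
    by (intro Bochner_Integration.integral_sum[symmetric] integrable_prod_list) (use assms in auto)
  also have "\<dots> = expectation (\<lambda>x. 0)"
  proof (rule integral_cong_AE)
    show "AE x in M. (\<Sum>i<p. \<Prod>j\<leftarrow>i # xs. d j x) = 0"
      using zero_sum by eventually_elim (simp flip: sum_distrib_right)
    have [measurable]: "(\<lambda>x. \<Prod>j\<leftarrow>ys. d j x) \<in> borel_measurable M" for ys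
      by (induction ys) auto
    show "(\<lambda>x. \<Sum>i<p. \<Prod>j\<leftarrow>i # xs. d j x) \<in> borel_measurable M"
      by (intro borel_measurable_sum) measurable
  qed auto
  finally show ?thesis by simp
qed

text \<open>The digits are the multiplicities of the distinct indices. The five quartic moments
  correspond to the five partitions of the number 4.\<close>

definition "m2 = mom [0, 0]"
definition "m4 = mom [0, 0, 0, 0]"
definition "m31 = mom [0, 0, 0, 1]"
definition "m22 = mom [0, 0, 1, 1]"
definition "m211 = mom [0, 0, 1, 2]"
definition "m1111 = mom [0, 1, 2, 3]"

lemmas m_defs = m2_def m4_def m31_def m22_def m211_def m1111_def

text \<open>Summing one index out of \<open>mom [i, 0]\<close> gives the off-diagonal value
  \<open>- m2 / (p - 1)\<close>; the \<open>of_bool\<close> merges it with the diagonal value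
  \<open>m2\<close>.\<close>

lemma mom2:
  assumes "2 \<le> p" "i < p" "j < p"
  shows "mom [i, j] = m2 * (real p * of_bool (i = j) - 1) / (real p - 1)"
proof -
  have diag: "mom [i, i] = m2" if "i < p" for i
    using mom_nth[of "[i]" "[0, 0]"] that by (simp add: m2_def)
  have off: "mom [i, j] = mom [0, 1]" if "i < p" "j < p" "i \<noteq> j" for i j
    using mom_nth[of "[i, j]" "[0, 1]"] that by simp
  have "(\<Sum>i<p. mom [i, 0]) = mom [0, 0] + (\<Sum>i\<in>{..<p} - {0}. mom [i, 0])"
    using assms by (subst sum.remove[of _ 0]) auto
  also have "(\<Sum>i\<in>{..<p} - {0}. mom [i, 0]) = (\<Sum>i\<in>{..<p} - {0}. mom [0, 1])"
    by (intro sum.cong off) auto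
  finally have "m2 + (real p - 1) * mom [0, 1] = 0"
    using mom_zero_sum[of "[0]"] assms by (simp add: m2_def card_Diff_subset of_nat_diff)
  then have "mom [0, 1] = - m2 / (real p - 1)"
    using assms by (simp add: field_simps)
  with diag[of i] off[of i j] assms show ?thesis
    by (cases "i = j") (auto simp: field_simps)
qed

section \<open>Fourth-order moments, their linear relations and their tensor form\<close>

lemma mom4_diag: "i < p \<Longrightarrow> mom [i, i, i, i] = m4"
  using mom_nth[of "[i]" "[0, 0, 0, 0]"] by (simp add: m4_def)

lemma mom4_cases:
  assumes "i < p" "j < p" "i \<noteq> j"
  shows "mom [i, i, i, j] = m31" "mom [i, i, j, i] = m31"
    "mom [i, j, i, i] = m31" "mom [j, i, i, i] = m31"
    "mom [i, i, j, j] = m22" "mom [i, j, i, j] = m22" "mom [i, j, j, i] = m22"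
proof -
  have 31: "mom [i, i, i, j] = m31"
    using assms mom_nth[of "[i, j]" "[0, 0, 0, 1]"] by (simp add: m31_def)
  have 22: "mom [i, i, j, j] = m22"
    using assms mom_nth[of "[i, j]" "[0, 0, 1, 1]"] by (simp add: m22_def)
  show "mom [i, i, i, j] = m31" "mom [i, i, j, i] = m31"
    "mom [i, j, i, i] = m31" "mom [j, i, i, i] = m31"
    by (subst mom_perm[of _ "[i, i, i, j]"]; simp add: 31)+
  show "mom [i, i, j, j] = m22" "mom [i, j, i, j] = m22" "mom [i, j, j, i] = m22"
    by (subst mom_perm[of _ "[i, i, j, j]"]; simp add: 22)+
qed

lemma mom4_cases':
  assumes "i < p" "j < p" "k < p" "i \<noteq> j" "i \<noteq> k" "j \<noteq> k"
  shows "mom [i, i, j, k] = m211" "mom [i, j, i, k] = m211" "mom [i, j, k, i] = m211"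
    "mom [j, i, i, k] = m211" "mom [j, i, k, i] = m211" "mom [j, k, i, i] = m211"
    and "l < p \<Longrightarrow> i \<noteq> l \<Longrightarrow> j \<noteq> l \<Longrightarrow> k \<noteq> l \<Longrightarrow> mom [i, j, k, l] = m1111"
proof -
  have 211: "mom [i, i, j, k] = m211"
    using assms mom_nth[of "[i, j, k]" "[0, 0, 1, 2]"] by (simp add: m211_def)
  show "mom [i, i, j, k] = m211" "mom [i, j, i, k] = m211" "mom [i, j, k, i] = m211"
    "mom [j, i, i, k] = m211" "mom [j, i, k, i] = m211" "mom [j, k, i, i] = m211"
    by (subst mom_perm[of _ "[i, i, j, k]"]; simp add: 211)+
  show "mom [i, j, k, l] = m1111" if "l < p" "i \<noteq> l" "j \<noteq> l" "k \<noteq> l"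
    using assms that mom_nth[of "[i, j, k, l]" "[0, 1, 2, 3]"] by (simp add: m1111_def)
qed

text \<open>Three indices are fixed with pattern 3, 21 or 111 and the fourth is summed out, sorted
  by whether it meets a fixed one. The chain determines \<open>m31\<close>, \<open>m211\<close> and
  \<open>m1111\<close> from \<open>m4\<close> and \<open>m22\<close>.\<close>

lemma mom_relations:
  assumes "4 \<le> p"
  shows "m4 + (real p - 1) * m31 = 0"
    and "m31 + m22 + (real p - 2) * m211 = 0"
    and "3 * m211 + (real p - 3) * m1111 = 0"
proof -
  have "(\<Sum>i<p. mom [i, 0, 0, 0]) = m4 + (\<Sum>i\<in>{..<p} - {0}. m31)"
    using assms by (subst sum.remove[of _ 0]) (auto simp: mom4_diag mom4_cases)
  then show "m4 + (real p - 1) * m31 = 0"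
    using mom_zero_sum[of "[0, 0, 0]"] assms by (simp add: card_Diff_subset of_nat_diff)
  have "(\<Sum>i<p. mom [i, 0, 0, 1]) = (\<Sum>i\<in>{0, 1}. mom [i, 0, 0, 1]) + (\<Sum>i\<in>{..<p} - {0, 1}. mom [i, 0, 0, 1])"
    using assms by (subst sum.subset_diff[of "{0, 1}"]) auto
  also have "(\<Sum>i\<in>{..<p} - {0, 1}. mom [i, 0, 0, 1]) = (\<Sum>i\<in>{..<p} - {0, 1}. m211)"
    using assms by (intro sum.cong) (auto simp: mom4_cases')
  also have "(\<Sum>i\<in>{0, 1}. mom [i, 0, 0, 1]) = m31 + m22"
    using assms by (simp add: mom4_cases)
  finally show "m31 + m22 + (real p - 2) * m211 = 0"
    using mom_zero_sum[of "[0, 0, 1]"] assms by (simp add: card_Diff_subset of_nat_diff)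
  have "(\<Sum>i<p. mom [i, 0, 1, 2]) = (\<Sum>i\<in>{0, 1, 2}. mom [i, 0, 1, 2]) + (\<Sum>i\<in>{..<p} - {0, 1, 2}. mom [i, 0, 1, 2])"
    using assms by (subst sum.subset_diff[of "{0, 1, 2}"]) auto
  also have "(\<Sum>i\<in>{..<p} - {0, 1, 2}. mom [i, 0, 1, 2]) = (\<Sum>i\<in>{..<p} - {0, 1, 2}. m1111)"
    using assms by (intro sum.cong) (auto simp: mom4_cases')
  also have "(\<Sum>i\<in>{0, 1, 2}. mom [i, 0, 1, 2]) = 3 * m211"
    using assms by (simp add: mom4_cases')
  finally show "3 * m211 + (real p - 3) * m1111 = 0"
    using mom_zero_sum[of "[0, 1, 2]"] assms by (simp add: card_Diff_subset of_nat_diff)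
qed

text \<open>Coefficients of the moment tensor in the basis of products of Kronecker deltas.\<close>

definition "e_coeff = m211 - m1111"
definition "c_coeff = m31 - 3 * e_coeff - m1111"
definition "b_coeff = m22 - 2 * e_coeff - m1111"
definition "a_coeff = m4 - 3 * b_coeff - 4 * c_coeff - 6 * e_coeff - m1111"

lemmas coeff_defs = a_coeff_def b_coeff_def c_coeff_def e_coeff_def

text \<open>The tensor depends only on which of the four positions coincide. A product of deltas
  contributes exactly where its coincidences hold, so matching the moments is a triangular system,
  which the coefficient definitions solve from the finest partition to the coarsest.\<close>

lemma mom4:
  fixes \<delta> :: "nat \<Rightarrow> nat \<Rightarrow> real"
  defines "\<delta> \<equiv> \<lambda>i j. if i = j then 1 else 0"
  assumes "i < p" "j < p" "k < p" "l < p"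
  shows "mom [i, j, k, l] =
      a_coeff * (\<delta> i j * (\<delta> i k * \<delta> i l))
    + b_coeff * (\<delta> i j * \<delta> k l + \<delta> i k * \<delta> j l + \<delta> i l * \<delta> j k)
    + c_coeff * (\<delta> i j * \<delta> i k + \<delta> i j * \<delta> i l + \<delta> i k * \<delta> i l + \<delta> j k * \<delta> j l)
    + e_coeff * (\<delta> i j + \<delta> i k + \<delta> i l + \<delta> j k + \<delta> j l + \<delta> k l)
    + m1111"
  by (cases "i = j"; cases "i = k"; cases "i = l"; cases "j = k"; cases "j = l"; cases "k = l")
     (simp_all add: assms mom4_diag mom4_cases mom4_cases' coeff_defs)

section \<open>Matrix sums against the moment tensors of order two and four\<close>

lemma quadratic_mom_sum:
  fixes A :: "nat \<Rightarrow> nat \<Rightarrow> complex"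
  assumes "2 \<le> p"
  shows "(\<Sum>i<p. \<Sum>j<p. A i j * of_real (mom [i, j])) =
     of_real (m2 / (real p - 1)) * (of_nat p * (\<Sum>i<p. A i i) - (\<Sum>i<p. \<Sum>j<p. A i j))"
proof -
  define \<rho> where "\<rho> = m2 / (real p - 1)"
  have mom: "mom [i, j] = \<rho> * (real p * of_bool (i = j) - 1)" if "i < p" "j < p" for i j
    using mom2[OF assms that] by (simp add: \<rho>_def)
  have "(\<Sum>i<p. \<Sum>j<p. A i j * of_real (mom [i, j])) =
    (\<Sum>i<p. \<Sum>j<p. of_real (m2 / (real p - 1)) * (of_nat p * (if i = j then A i j else 0) - A i j))"
    unfolding \<rho>_def[symmetric] by (intro sum.cong refl) (auto simp: mom algebra_simps)
  also have "\<dots> = of_real (m2 / (real p - 1)) *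
      (of_nat p * (\<Sum>i<p. \<Sum>j<p. if i = j then A i j else 0) - (\<Sum>i<p. \<Sum>j<p. A i j))"
    by (simp only: sum_distrib_left sum_subtractf right_diff_distrib)
  also have "(\<Sum>i<p. \<Sum>j<p. if i = j then A i j else 0) = (\<Sum>i<p. A i i)"
    by (intro sum.cong refl) simp
  finally show ?thesis .
qed

text \<open>Each product of deltas collapses the fourfold sum to one of the quantities that
  \<open>l2_bounded\<close> controls: diagonals, Frobenius pairings, row and column sums, traces and
  total sums.\<close>

lemma quartic_mom_sum:
  fixes A B :: "nat \<Rightarrow> nat \<Rightarrow> complex"
  shows "(\<Sum>i<p. \<Sum>j<p. \<Sum>k<p. \<Sum>l<p. A i j * B k l * of_real (mom [i, j, k, l])) =
      of_real a_coeff * (\<Sum>i<p. A i i * B i i)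
    + of_real b_coeff * ((\<Sum>i<p. A i i) * (\<Sum>i<p. B i i) + (\<Sum>i<p. \<Sum>j<p. A i j * B i j)
        + (\<Sum>i<p. \<Sum>j<p. A i j * B j i))
    + of_real c_coeff * ((\<Sum>i<p. A i i * (\<Sum>j<p. B i j)) + (\<Sum>i<p. A i i * (\<Sum>j<p. B j i))
        + (\<Sum>i<p. (\<Sum>j<p. A i j) * B i i) + (\<Sum>i<p. (\<Sum>j<p. A j i) * B i i))
    + of_real e_coeff * ((\<Sum>i<p. A i i) * (\<Sum>i<p. \<Sum>j<p. B i j)
        + (\<Sum>i<p. (\<Sum>j<p. A i j) * (\<Sum>j<p. B i j)) + (\<Sum>i<p. (\<Sum>j<p. A i j) * (\<Sum>j<p. B j i))
        + (\<Sum>i<p. (\<Sum>j<p. A j i) * (\<Sum>j<p. B i j)) + (\<Sum>i<p. (\<Sum>j<p. A j i) * (\<Sum>j<p. B j i))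
        + (\<Sum>i<p. \<Sum>j<p. A i j) * (\<Sum>i<p. B i i))
    + of_real m1111 * ((\<Sum>i<p. \<Sum>j<p. A i j) * (\<Sum>i<p. \<Sum>j<p. B i j))"
proof -
  define \<delta> :: "nat \<Rightarrow> nat \<Rightarrow> complex" where "\<delta> i j = (if i = j then 1 else 0)" for i j
  define \<Sigma> where "\<Sigma> F = (\<Sum>i<p. \<Sum>j<p. \<Sum>k<p. \<Sum>l<p. A i j * B k l * F i j k l)"
    for F :: "nat \<Rightarrow> nat \<Rightarrow> nat \<Rightarrow> nat \<Rightarrow> complex"
  have add: "\<Sigma> (\<lambda>i j k l. F i j k l + G i j k l) = \<Sigma> F + \<Sigma> G" for F G
    by (simp add: \<Sigma>_def distrib_left sum.distrib)
  have scale: "\<Sigma> (\<lambda>i j k l. z * F i j k l) = z * \<Sigma> F" for z F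
    by (simp add: \<Sigma>_def sum_distrib_left mult_ac)
  have "(\<Sum>i<p. \<Sum>j<p. \<Sum>k<p. \<Sum>l<p. A i j * B k l * of_real (mom [i, j, k, l])) =
    \<Sigma> (\<lambda>i j k l. of_real a_coeff * (\<delta> i j * (\<delta> i k * \<delta> i l))
    + of_real b_coeff * (\<delta> i j * \<delta> k l + \<delta> i k * \<delta> j l + \<delta> i l * \<delta> j k)
    + of_real c_coeff * (\<delta> i j * \<delta> i k + \<delta> i j * \<delta> i l + \<delta> i k * \<delta> i l + \<delta> j k * \<delta> j l)
    + of_real e_coeff * (\<delta> i j + \<delta> i k + \<delta> i l + \<delta> j k + \<delta> j l + \<delta> k l)
    + of_real m1111 * 1)"
    unfolding \<Sigma>_def
  proof (intro sum.cong refl arg_cong2[where f = "(*)"])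
    fix i j k l assume "i \<in> {..<p}" "j \<in> {..<p}" "k \<in> {..<p}" "l \<in> {..<p}"
    moreover have "\<delta> i j = of_real (if i = j then 1 else 0)" for i j
      by (simp add: \<delta>_def)
    ultimately show "complex_of_real (mom [i, j, k, l]) = of_real a_coeff * (\<delta> i j * (\<delta> i k * \<delta> i l))
    + of_real b_coeff * (\<delta> i j * \<delta> k l + \<delta> i k * \<delta> j l + \<delta> i l * \<delta> j k)
    + of_real c_coeff * (\<delta> i j * \<delta> i k + \<delta> i j * \<delta> i l + \<delta> i k * \<delta> i l + \<delta> j k * \<delta> j l)
    + of_real e_coeff * (\<delta> i j + \<delta> i k + \<delta> i l + \<delta> j k + \<delta> j l + \<delta> k l)
    + of_real m1111 * 1"
      by (simp only: mom4 lessThan_iff of_real_add of_real_mult mult_1_right)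
  qed
  also have "\<dots> = of_real a_coeff * \<Sigma> (\<lambda>i j k l. \<delta> i j * (\<delta> i k * \<delta> i l))
    + of_real b_coeff * (\<Sigma> (\<lambda>i j k l. \<delta> i j * \<delta> k l) + \<Sigma> (\<lambda>i j k l. \<delta> i k * \<delta> j l) + \<Sigma> (\<lambda>i j k l. \<delta> i l * \<delta> j k))
    + of_real c_coeff * (\<Sigma> (\<lambda>i j k l. \<delta> i j * \<delta> i k) + \<Sigma> (\<lambda>i j k l. \<delta> i j * \<delta> i l)
       + \<Sigma> (\<lambda>i j k l. \<delta> i k * \<delta> i l) + \<Sigma> (\<lambda>i j k l. \<delta> j k * \<delta> j l))
    + of_real e_coeff * (\<Sigma> (\<lambda>i j k l. \<delta> i j) + \<Sigma> (\<lambda>i j k l. \<delta> i k) + \<Sigma> (\<lambda>i j k l. \<delta> i l)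
       + \<Sigma> (\<lambda>i j k l. \<delta> j k) + \<Sigma> (\<lambda>i j k l. \<delta> j l) + \<Sigma> (\<lambda>i j k l. \<delta> k l))
    + of_real m1111 * \<Sigma> (\<lambda>_ _ _ _. 1)"
    by (simp only: add scale)
  also have "\<Sigma> (\<lambda>i j k l. \<delta> i j * (\<delta> i k * \<delta> i l)) = (\<Sum>i<p. A i i * B i i)"
    by (simp add: \<Sigma>_def \<delta>_def mult_delta_right sum_if_const cong: sum.cong_simp)
  also have "\<Sigma> (\<lambda>i j k l. \<delta> i j * \<delta> k l) = (\<Sum>i<p. A i i) * (\<Sum>i<p. B i i)"
    by (simp add: \<Sigma>_def \<delta>_def mult_delta_right sum_if_const sum_product cong: sum.cong_simp)
  also have "\<Sigma> (\<lambda>i j k l. \<delta> i k * \<delta> j l) = (\<Sum>i<p. \<Sum>j<p. A i j * B i j)"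
    by (simp add: \<Sigma>_def \<delta>_def mult_delta_right sum_if_const cong: sum.cong_simp)
  also have "\<Sigma> (\<lambda>i j k l. \<delta> i l * \<delta> j k) = (\<Sum>i<p. \<Sum>j<p. A i j * B j i)"
    by (simp add: \<Sigma>_def \<delta>_def mult_delta_right sum_if_const cong: sum.cong_simp)
  also have "\<Sigma> (\<lambda>i j k l. \<delta> i j * \<delta> i k) = (\<Sum>i<p. A i i * (\<Sum>j<p. B i j))"
    by (simp add: \<Sigma>_def \<delta>_def mult_delta_right sum_if_const sum_distrib_left cong: sum.cong_simp)
  also have "\<Sigma> (\<lambda>i j k l. \<delta> i j * \<delta> i l) = (\<Sum>i<p. A i i * (\<Sum>j<p. B j i))"
    by (simp add: \<Sigma>_def \<delta>_def mult_delta_right sum_if_const sum_distrib_left cong: sum.cong_simp)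
  also have "\<Sigma> (\<lambda>i j k l. \<delta> i k * \<delta> i l) = (\<Sum>i<p. (\<Sum>j<p. A i j) * B i i)"
    by (simp add: \<Sigma>_def \<delta>_def mult_delta_right sum_if_const sum_distrib_right cong: sum.cong_simp)
  \<comment> \<open>These deltas tie \<open>k\<close> and \<open>l\<close> to \<open>j\<close>, so
    \<open>j\<close> is made the outer index and the free index \<open>i\<close> is summed inside,
    producing column sums of \<open>A\<close>.\<close>
  also have "\<Sigma> (\<lambda>i j k l. \<delta> j k * \<delta> j l) = (\<Sum>i<p. (\<Sum>j<p. A j i) * B i i)"
    unfolding \<Sigma>_def
    by (subst sum.swap) (simp add: \<delta>_def mult_delta_right sum_if_const sum_distrib_right cong: sum.cong_simp)
  also have "\<Sigma> (\<lambda>i j k l. \<delta> i j) = (\<Sum>i<p. A i i) * (\<Sum>i<p. \<Sum>j<p. B i j)"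
    by (simp add: \<Sigma>_def \<delta>_def mult_delta_right sum_if_const cong: sum.cong_simp
      flip: sum_distrib_left sum_distrib_right)
  also have "\<Sigma> (\<lambda>i j k l. \<delta> i k) = (\<Sum>i<p. (\<Sum>j<p. A i j) * (\<Sum>j<p. B i j))"
    by (simp add: \<Sigma>_def \<delta>_def mult_delta_right sum_if_const sum_product cong: sum.cong_simp)
  also have "\<Sigma> (\<lambda>i j k l. \<delta> i l) = (\<Sum>i<p. (\<Sum>j<p. A i j) * (\<Sum>j<p. B j i))"
    by (simp add: \<Sigma>_def \<delta>_def mult_delta_right sum_if_const sum_product cong: sum.cong_simp)
  also have "\<Sigma> (\<lambda>i j k l. \<delta> j k) = (\<Sum>i<p. (\<Sum>j<p. A j i) * (\<Sum>j<p. B i j))"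
    unfolding \<Sigma>_def
    by (subst sum.swap) (simp add: \<delta>_def mult_delta_right sum_if_const sum_product cong: sum.cong_simp)
  also have "\<Sigma> (\<lambda>i j k l. \<delta> j l) = (\<Sum>i<p. (\<Sum>j<p. A j i) * (\<Sum>j<p. B j i))"
    unfolding \<Sigma>_def
    by (subst sum.swap) (simp add: \<delta>_def mult_delta_right sum_if_const sum_product cong: sum.cong_simp)
  also have "\<Sigma> (\<lambda>i j k l. \<delta> k l) = (\<Sum>i<p. \<Sum>j<p. A i j) * (\<Sum>i<p. B i i)"
    by (simp add: \<Sigma>_def \<delta>_def mult_delta_right sum_if_const cong: sum.cong_simp
      flip: sum_distrib_left sum_distrib_right)
  also have "\<Sigma> (\<lambda>_ _ _ _. 1) = (\<Sum>i<p. \<Sum>j<p. A i j) * (\<Sum>i<p. \<Sum>j<p. B i j)"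
    by (simp add: \<Sigma>_def flip: sum_distrib_left sum_distrib_right)
  finally show ?thesis .
qed

section \<open>Size of the moments and of the tensor coefficients\<close>

lemma integrable_d [simp]:
  assumes "i < p"
  shows "integrable M (\<lambda>x. d i x ^ 4)" "integrable M (\<lambda>x. (d i x)\<^sup>2)"
    and "j < p \<Longrightarrow> integrable M (\<lambda>x. d i x * d j x)"
    and "j < p \<Longrightarrow> integrable M (\<lambda>x. (d i x)\<^sup>2 * (d j x)\<^sup>2)"
    and "j < p \<Longrightarrow> k < p \<Longrightarrow> l < p \<Longrightarrow> integrable M (\<lambda>x. d i x * d j x * d k x * d l x)"
  using integrable_prod_list[of "[i, i, i, i]"] integrable_prod_list[of "[i, i]"]
    integrable_prod_list[of "[i, j]"] integrable_prod_list[of "[i, i, j, j]"]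
    integrable_prod_list[of "[i, j, k, l]"] assms
  by (simp_all add: mult.assoc power2_eq_square power4_eq_xxxx)

lemma m2_eq: "m2 = expectation (\<lambda>x. (d 0 x)\<^sup>2)"
  and m4_eq: "m4 = expectation (\<lambda>x. d 0 x ^ 4)"
  and m22_eq: "m22 = expectation (\<lambda>x. (d 0 x)\<^sup>2 * (d 1 x)\<^sup>2)"
  by (simp_all add: m_defs mom_def mult.assoc power2_eq_square power4_eq_xxxx)

lemma m4_nonneg: "0 \<le> m4" and m22_nonneg: "0 \<le> m22"
  by (simp_all add: m4_eq m22_eq)

text \<open>Young's inequality, both fourth moments being \<open>m4\<close>. Together with
  \<open>m2_square_le_m4\<close> this makes \<open>m4\<close> the common scale of the error
  terms.\<close>

lemma m22_le_m4:
  assumes "2 \<le> p"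
  shows "m22 \<le> m4"
proof -
  have "expectation (\<lambda>x. d 1 x ^ 4) = m4"
    using mom4_diag[of 1] assms by (simp add: mom_def mult.assoc power4_eq_xxxx)
  have "(d 0 x)\<^sup>2 * (d 1 x)\<^sup>2 \<le> (d 0 x ^ 4 + d 1 x ^ 4) / 2" for x
    using sum_squares_bound[of "(d 0 x)\<^sup>2" "(d 1 x)\<^sup>2"] by simp
  then have "m22 \<le> expectation (\<lambda>x. (d 0 x ^ 4 + d 1 x ^ 4) / 2)"
    unfolding m22_eq using assms by (intro integral_mono) auto
  also have "\<dots> = m4"
    using assms \<open>expectation (\<lambda>x. d 1 x ^ 4) = m4\<close> by (simp add: m4_eq)
  finally show ?thesis .
qed

lemma m2_square_le_m4:
  assumes "1 \<le> p"
  shows "m2\<^sup>2 \<le> m4"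
proof -
  have "0 \<le> variance (\<lambda>x. (d 0 x)\<^sup>2)"
    by (rule variance_positive)
  also have "\<dots> = m4 - m2\<^sup>2"
    using assms by (subst variance_eq) (simp_all add: m2_eq m4_eq flip: power_mult)
  finally show ?thesis by simp
qed

text \<open>The constants are crude; what matters is that they are absolute. The first five bounds
  follow from the relations with \<open>q / (q - 1) \<le> 4 / 3\<close>,
  \<open>q / (q - 2) \<le> 2\<close> and \<open>q / (q - 3) \<le> 4\<close>. The last is the
  decisive cancellation: \<open>e_coeff\<close> alone is only of order \<open>m4 / p\<close>, but
  its leading part is \<open>- m22 / p\<close>, which \<open>m2\<^sup>2 / (p - 1)\<close> offsets up
  to the difference \<open>m22 - m2\<^sup>2\<close>.\<close>

lemma coeff_bounds:
  assumes p: "4 \<le> p"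
  shows "real p * \<bar>a_coeff - (m4 - 3 * m22)\<bar> \<le> 128 * m4"
    and "real p * \<bar>b_coeff - m22\<bar> \<le> 20 * m4"
    and "real p * \<bar>c_coeff\<bar> \<le> 38 * m4"
    and "real p * \<bar>e_coeff\<bar> \<le> 16 * m4"
    and "(real p)\<^sup>2 * \<bar>m1111\<bar> \<le> 48 * m4"
    and "(real p)\<^sup>2 * \<bar>e_coeff + m2\<^sup>2 / (real p - 1)\<bar> \<le> 54 * m4 + 2 * real p * \<bar>m22 - m2\<^sup>2\<bar>"
proof -
  define q where "q = real p"
  have q: "4 \<le> q" using p by (simp add: q_def)
  have m22: "0 \<le> m22" "m22 \<le> m4" "m2\<^sup>2 \<le> m4" "0 \<le> m4"
    using m4_nonneg m22_nonneg m22_le_m4 m2_square_le_m4 p by auto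
  have rel: "m31 = - m4 / (q - 1)" "m211 = - ((m31 + m22) / (q - 2))" "m1111 = - 3 * m211 / (q - 3)"
    using mom_relations[OF p] q by (simp_all add: field_simps q_def)
  have "q * \<bar>m31\<bar> = q / (q - 1) * m4"
    using q m22 by (simp add: rel(1))
  also have "\<dots> \<le> 4 / 3 * m4"
    using q m22 by (intro mult_right_mono) (auto simp: field_simps)
  finally have q31: "q * \<bar>m31\<bar> \<le> 4 / 3 * m4" .
  have "4 * \<bar>m31\<bar> \<le> q * \<bar>m31\<bar>"
    using q by (intro mult_right_mono) auto
  with q31 have m31: "\<bar>m31\<bar> \<le> m4"
    using m22 by linarith
  have "q * \<bar>m211\<bar> = q / (q - 2) * \<bar>m31 + m22\<bar>"
    using q by (simp add: rel(2))
  also have "\<dots> \<le> 2 * (2 * m4)"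
    using q m22 m31 by (intro mult_mono) (auto simp: field_simps)
  finally have q211: "q * \<bar>m211\<bar> \<le> 4 * m4" by (simp only: mult.assoc[symmetric])
  have "q\<^sup>2 * \<bar>m1111\<bar> = 3 * (q / (q - 3)) * (q * \<bar>m211\<bar>)"
    using q by (simp add: rel(3) abs_mult power2_eq_square)
  also have "\<dots> \<le> 3 * 4 * (4 * m4)"
    using q by (intro mult_mono q211) (auto simp: field_simps)
  finally have q1111: "q\<^sup>2 * \<bar>m1111\<bar> \<le> 48 * m4" by simp
  have "4 * (q * \<bar>m1111\<bar>) \<le> q * (q * \<bar>m1111\<bar>)"
    using q by (intro mult_right_mono) auto
  with q1111 have q1111': "q * \<bar>m1111\<bar> \<le> 12 * m4"
    by (simp add: power2_eq_square mult.assoc)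
  \<comment> \<open>The coefficients are linear in \<open>m31\<close>, \<open>m211\<close> and
    \<open>m1111\<close>; splitting absolute values into two inequalities leaves linear
    arithmetic.\<close>
  have two_sided: "q * x \<le> b \<and> - (q * x) \<le> b" if "q * \<bar>x\<bar> \<le> b" for x b
  proof -
    have "q * x \<le> q * \<bar>x\<bar>" "q * - x \<le> q * \<bar>x\<bar>"
      using q by (intro mult_left_mono; simp)+
    with that show ?thesis
      by (intro conjI; linarith)
  qed
  have scaled: "q * \<bar>x\<bar> \<le> b" if "q * x \<le> b" "- (q * x) \<le> b" for x b
    using that by (auto simp: abs_if)
  note lin = two_sided[OF q31] two_sided[OF q211] two_sided[OF q1111'] m22
  \<comment> \<open>With the bounds 4/3, 4 and 12 (times \<open>m4\<close>) for \<open>q\<close>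
    times the three moments, the constants are rounded sums, for instance 12 * 4 + 6 * 12 + 4 * 4/3
    \<le> 128.\<close>
  have "a_coeff - (m4 - 3 * m22) = 12 * m211 - 6 * m1111 - 4 * m31"
    "b_coeff - m22 = m1111 - 2 * m211" "c_coeff = m31 - 3 * m211 + 2 * m1111"
    by (simp_all add: coeff_defs)
  with lin show "real p * \<bar>a_coeff - (m4 - 3 * m22)\<bar> \<le> 128 * m4"
    "real p * \<bar>b_coeff - m22\<bar> \<le> 20 * m4"
    "real p * \<bar>c_coeff\<bar> \<le> 38 * m4"
    "real p * \<bar>e_coeff\<bar> \<le> 16 * m4"
    unfolding q_def[symmetric] e_coeff_def by (auto intro!: scaled simp: right_diff_distrib distrib_left)
  show "(real p)\<^sup>2 * \<bar>m1111\<bar> \<le> 48 * m4"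
    using q1111 by (simp add: q_def)
  \<comment> \<open>The partial fraction relation \<open>v = u + u * v\<close> is the only fact
    about the two reciprocals that the cancellation uses. The two sides of the identity below differ
    by a multiple of \<open>u + u * v - v\<close>.\<close>
  define u v where "u = 1 / (q - 1)" and "v = 1 / (q - 2)"
  have "u * (q - 1) = 1" "v * (q - 2) = 1"
    using q by (simp_all add: u_def v_def)
  moreover have "v - (u + u * v) = v * (1 - u * (q - 1)) - u * (1 - v * (q - 2))"
    by (simp add: algebra_simps)
  ultimately have uv: "v = u + u * v"
    by simp
  have "q\<^sup>2 * (- ((m31 + m22) * v) - m1111 + m2\<^sup>2 * u) -
      (- (q * v * (q * m31)) - q\<^sup>2 * m1111 + q * u * (q * (m2\<^sup>2 - m22)) - q * u * (q * v) * m22)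
    = q\<^sup>2 * m22 * ((u + u * v) - v)"
    by (simp add: algebra_simps power2_eq_square)
  then have "q\<^sup>2 * (- ((m31 + m22) * v) - m1111 + m2\<^sup>2 * u) =
      - (q * v * (q * m31)) - q\<^sup>2 * m1111 + q * u * (q * (m2\<^sup>2 - m22)) - q * u * (q * v) * m22"
    unfolding uv[symmetric] by simp
  then have "q\<^sup>2 * (e_coeff + m2\<^sup>2 / (q - 1)) =
      - (q / (q - 2) * (q * m31)) - q\<^sup>2 * m1111 + q / (q - 1) * (q * (m2\<^sup>2 - m22)) - (q / (q - 1)) * (q / (q - 2)) * m22"
    unfolding e_coeff_def rel(2) u_def v_def by simp
  moreover have "\<bar>q / (q - 2) * (q * m31)\<bar> \<le> 2 * (4 / 3 * m4)"
    unfolding abs_mult[of "q / (q - 2)"] using q q31 by (intro mult_mono) (auto simp: field_simps abs_mult)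
  moreover have "\<bar>q / (q - 1) * (q * (m2\<^sup>2 - m22))\<bar> \<le> 2 * (q * \<bar>m22 - m2\<^sup>2\<bar>)"
    unfolding abs_mult using q by (intro mult_mono) (auto simp: field_simps abs_minus_commute)
  moreover have "\<bar>(q / (q - 1)) * (q / (q - 2)) * m22\<bar> \<le> (4 / 3) * 2 * m4"
    unfolding abs_mult using q m22 by (intro mult_mono) (auto simp: field_simps)
  moreover have "\<bar>q\<^sup>2 * m1111\<bar> \<le> 48 * m4"
    using q1111 by (simp add: abs_mult)
  \<comment> \<open>The constant 54 rounds up 8/3 + 48 + 8/3.\<close>
  ultimately have "\<bar>q\<^sup>2 * (e_coeff + m2\<^sup>2 / (q - 1))\<bar> \<le> 54 * m4 + 2 * (q * \<bar>m22 - m2\<^sup>2\<bar>)"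
    using m22(4) by (simp only: abs_le_iff) linarith
  then show "(real p)\<^sup>2 * \<bar>e_coeff + m2\<^sup>2 / (real p - 1)\<bar> \<le> 54 * m4 + 2 * real p * \<bar>m22 - m2\<^sup>2\<bar>"
    by (simp add: q_def abs_mult)
qed

section \<open>Covariance of two quadratic forms\<close>

definition qform :: "(nat \<Rightarrow> nat \<Rightarrow> complex) \<Rightarrow> 'a \<Rightarrow> complex" where
  "qform A x = (\<Sum>i<p. \<Sum>j<p. A i j * of_real (d i x * d j x))"

lemma has_bochner_integral_qform:
  "has_bochner_integral M (qform A) (\<Sum>i<p. \<Sum>j<p. A i j * of_real (mom [i, j]))"
proof -
  have "has_bochner_integral M (\<lambda>x. d i x * d j x) (mom [i, j])" if "i < p" "j < p" for i j
    using that by (simp add: has_bochner_integral_iff mom_def)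
  then show ?thesis
    unfolding qform_def
    by (intro has_bochner_integral_sum has_bochner_integral_mult_right has_bochner_integral_of_real) auto
qed

lemma qform_mult:
  "qform A x * qform B x =
    (\<Sum>i<p. \<Sum>j<p. \<Sum>k<p. \<Sum>l<p. A i j * B k l * of_real (d i x * d j x * d k x * d l x))"
proof -
  have "qform A x * qform B x = (\<Sum>i<p. \<Sum>j<p. A i j * of_real (d i x * d j x) * qform B x)"
    by (simp add: qform_def[of A] sum_distrib_right)
  also have "\<dots> = (\<Sum>i<p. \<Sum>j<p. \<Sum>k<p. \<Sum>l<p. A i j * B k l * of_real (d i x * d j x * d k x * d l x))"
    unfolding qform_def sum_distrib_left by (intro sum.cong refl) (simp add: mult_ac)
  finally show ?thesis .
qed

lemma has_bochner_integral_qform_mult: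
  "has_bochner_integral M (\<lambda>x. qform A x * qform B x)
    (\<Sum>i<p. \<Sum>j<p. \<Sum>k<p. \<Sum>l<p. A i j * B k l * of_real (mom [i, j, k, l]))"
proof -
  have "has_bochner_integral M (\<lambda>x. d i x * d j x * d k x * d l x) (mom [i, j, k, l])"
    if "i < p" "j < p" "k < p" "l < p" for i j k l
    using that integrable_prod_list[of "[i, j, k, l]"]
    by (simp add: has_bochner_integral_iff mom_def mult.assoc)
  then show ?thesis
    unfolding qform_mult
    by (intro has_bochner_integral_sum has_bochner_integral_mult_right has_bochner_integral_of_real) auto
qed

text \<open>This is the non-asymptotic core. The difference regroups into six products of a
  coefficient and a matrix quantity: \<open>D\<close>, \<open>F\<close>, \<open>T\<close>,
  \<open>R\<close> are of order \<open>K\<^sup>2 * p\<close> and meet coefficients of order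
  \<open>m4 / p\<close>. The products of traces and total sums are of order
  \<open>K\<^sup>2 * p\<^sup>2\<close> and meet \<open>m1111\<close> and \<open>g\<close>, for which
  \<open>coeff_bounds\<close> controls \<open>p\<^sup>2\<close> times the coefficient.\<close>

theorem quadratic_form_covariance:
  assumes p: "4 \<le> p" and K: "0 \<le> K" and A: "l2_bounded K p A" and B: "l2_bounded K p B"
  shows "cmod ((\<integral>x. (qform A x - of_real m2 * (\<Sum>i<p. A i i)) * (qform B x - of_real m2 * (\<Sum>i<p. B i i)) \<partial>M)
      - (of_real (m4 - 3 * m22) * (\<Sum>i<p. A i i * B i i)
        + of_real m22 * ((\<Sum>i<p. \<Sum>j<p. A i j * B i j) + (\<Sum>i<p. \<Sum>j<p. A i j * B j i))
        + of_real (m22 - m2\<^sup>2) * ((\<Sum>i<p. A i i) * (\<Sum>i<p. B i i))))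
    \<le> K\<^sup>2 * (696 * m4 + 8 * real p * \<bar>m22 - m2\<^sup>2\<bar>)"
proof -
  define tA tB where "tA = (\<Sum>i<p. A i i)" and "tB = (\<Sum>i<p. B i i)"
  define sA sB where "sA = (\<Sum>i<p. \<Sum>j<p. A i j)" and "sB = (\<Sum>i<p. \<Sum>j<p. B i j)"
  define D where "D = (\<Sum>i<p. A i i * B i i)"
  define F where "F = (\<Sum>i<p. \<Sum>j<p. A i j * B i j) + (\<Sum>i<p. \<Sum>j<p. A i j * B j i)"
  define T where "T = (\<Sum>i<p. A i i * (\<Sum>j<p. B i j)) + (\<Sum>i<p. A i i * (\<Sum>j<p. B j i))
        + (\<Sum>i<p. (\<Sum>j<p. A i j) * B i i) + (\<Sum>i<p. (\<Sum>j<p. A j i) * B i i)"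
  define R where "R = (\<Sum>i<p. (\<Sum>j<p. A i j) * (\<Sum>j<p. B i j)) + (\<Sum>i<p. (\<Sum>j<p. A i j) * (\<Sum>j<p. B j i))
        + (\<Sum>i<p. (\<Sum>j<p. A j i) * (\<Sum>j<p. B i j)) + (\<Sum>i<p. (\<Sum>j<p. A j i) * (\<Sum>j<p. B j i))"
  define g where "g = e_coeff + m2\<^sup>2 / (real p - 1)"
  define \<rho> where "\<rho> = m2 / (real p - 1)"
  let ?c = complex_of_real
  have rel: "?c \<rho> * (of_nat p - 1) = ?c m2"
  proof -
    have "\<rho> * (real p - 1) = m2"
      using p by (simp add: \<rho>_def)
    then have "?c (\<rho> * (real p - 1)) = ?c m2"
      by (rule arg_cong)
    then show ?thesis
      by simp
  qed
  have "has_bochner_integral M (\<lambda>x. qform A x * qform B x - ?c m2 * tB * qform A x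
      - ?c m2 * tA * qform B x + ?c m2 * tA * (?c m2 * tB))
    ((?c a_coeff * D + ?c b_coeff * (tA * tB + F) + ?c c_coeff * T + ?c e_coeff * (tA * sB + R + sA * tB)
      + ?c m1111 * (sA * sB))
      - ?c m2 * tB * (?c \<rho> * (of_nat p * tA - sA)) - ?c m2 * tA * (?c \<rho> * (of_nat p * tB - sB))
      + ?c m2 * tA * (?c m2 * tB))"
    using has_bochner_integral_qform_mult[of A B, unfolded quartic_mom_sum]
      has_bochner_integral_qform[of A] has_bochner_integral_qform[of B] p
      quadratic_mom_sum[of A] quadratic_mom_sum[of B]
    by (intro has_bochner_integral_add has_bochner_integral_diff has_bochner_integral_mult_right)
       (simp_all add: tA_def tB_def sA_def sB_def D_def F_def T_def R_def \<rho>_def add.assoc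
         has_bochner_integral_iff prob_space)
  also have "(\<lambda>x. qform A x * qform B x - ?c m2 * tB * qform A x
      - ?c m2 * tA * qform B x + ?c m2 * tA * (?c m2 * tB)) =
      (\<lambda>x. (qform A x - ?c m2 * tA) * (qform B x - ?c m2 * tB))"
    by (simp add: fun_eq_iff algebra_simps)
  finally have I: "(\<integral>x. (qform A x - ?c m2 * tA) * (qform B x - ?c m2 * tB) \<partial>M) =
     (?c a_coeff * D + ?c b_coeff * (tA * tB + F) + ?c c_coeff * T + ?c e_coeff * (tA * sB + R + sA * tB)
      + ?c m1111 * (sA * sB))
      - ?c m2 * tB * (?c \<rho> * (of_nat p * tA - sA)) - ?c m2 * tA * (?c \<rho> * (of_nat p * tB - sB))
      + ?c m2 * tA * (?c m2 * tB)"
    by (rule has_bochner_integral_integral_eq)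
  \<comment> \<open>The mean of a form is not exactly \<open>m2\<close> times the trace. The defect,
    multiplied by the centring of the other form, yields the \<open>m2 * \<rho>\<close> that turns
    \<open>e_coeff\<close> into \<open>g\<close>.\<close>
  have r: "?c \<rho> * (of_nat p * tA - sA) = ?c m2 * tA + ?c \<rho> * (tA - sA)"
    "?c \<rho> * (of_nat p * tB - sB) = ?c m2 * tB + ?c \<rho> * (tB - sB)"
    unfolding rel[symmetric] by (simp_all add: algebra_simps)
  have g: "g = e_coeff + m2 * \<rho>"
    by (simp add: g_def \<rho>_def power2_eq_square)
  have b: "b_coeff = m22 - 2 * e_coeff - m1111"
    by (simp add: b_coeff_def)
  \<comment> \<open>Substituting \<open>b_coeff\<close> in front of \<open>tA * tB\<close> releases
    the main term with \<open>m22 - m2\<^sup>2\<close>; the leftovers \<open>- 2 * e_coeff\<close>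
    and \<open>- m1111\<close> join the groups with coefficients \<open>g\<close> and
    \<open>m1111\<close>.\<close>
  have eq: "(\<integral>x. (qform A x - ?c m2 * tA) * (qform B x - ?c m2 * tB) \<partial>M)
      - (?c (m4 - 3 * m22) * D + ?c m22 * F + ?c (m22 - m2\<^sup>2) * (tA * tB)) =
      ?c (a_coeff - (m4 - 3 * m22)) * D + ?c (b_coeff - m22) * F + ?c c_coeff * T + ?c e_coeff * R
      + ?c m1111 * (sA * sB - tA * tB) + ?c g * (tA * sB + sA * tB - 2 * tA * tB)"
    unfolding I r g b by (simp add: algebra_simps power2_eq_square)
  note Ab = A[unfolded l2_bounded_def] l2_bounded_diagonal[OF A]
  note Bb = B[unfolded l2_bounded_def] l2_bounded_diagonal[OF B]
  let ?P = "K\<^sup>2 * real p"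
  have nD: "cmod D \<le> ?P"
    unfolding D_def using Ab Bb by (intro norm_sum_mult_le) auto
  have nF: "cmod F \<le> 2 * ?P"
    unfolding F_def using norm_sum_mult_entries_le[OF A B] by (intro norm_triangle_le) simp
  have nT: "cmod T \<le> 4 * ?P"
  proof -
    have "cmod T \<le> ?P + ?P + ?P + ?P"
      unfolding T_def by (intro norm_triangle_mono norm_sum_mult_le) (use Ab Bb in simp_all)
    then show ?thesis by linarith
  qed
  have nR: "cmod R \<le> 4 * ?P"
  proof -
    have "cmod R \<le> ?P + ?P + ?P + ?P"
      unfolding R_def using Ab Bb by (intro norm_triangle_mono norm_sum_mult_le) auto
    then show ?thesis by linarith
  qed
  have n1: "cmod tA \<le> K * real p" "cmod tB \<le> K * real p" "cmod sA \<le> K * real p" "cmod sB \<le> K * real p"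
    unfolding tA_def tB_def sA_def sB_def using Ab Bb K
    by (auto intro!: norm_sum_le_of_sum_squares)
  have prod: "cmod (a * b) \<le> ?P * real p" if "cmod a \<le> K * real p" "cmod b \<le> K * real p" for a b
  proof -
    have "cmod a * cmod b \<le> (K * real p) * (K * real p)"
      using that K by (intro mult_mono) auto
    then show ?thesis by (simp add: norm_mult power2_eq_square mult_ac)
  qed
  have nS: "cmod (sA * sB - tA * tB) \<le> 2 * (?P * real p)"
    using prod[OF n1(3,4)] prod[OF n1(1,2)] by (intro norm_triangle_le_diff) simp
  have nG: "cmod (tA * sB + sA * tB - 2 * tA * tB) \<le> 4 * (?P * real p)"
  proof -
    have "cmod (tA * sB + sA * tB - 2 * tA * tB) \<le> cmod (tA * sB) + cmod (sA * tB) + cmod (2 * (tA * tB))"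
      by (intro norm_triangle_le_diff add_mono norm_triangle_ineq) (simp add: mult.assoc)
    also have "\<dots> \<le> 4 * (?P * real p)"
      using prod[OF n1(1,4)] prod[OF n1(3,2)] prod[OF n1(1,2)] by (simp add: norm_mult mult.assoc)
    finally show ?thesis .
  qed
  note cb = coeff_bounds[OF p]
  \<comment> \<open>A coefficient of order \<open>1 / p\<close> against a sum of order
    \<open>p\<close>; \<open>scale2\<close> does the same for \<open>1 / p\<^sup>2\<close> against
    \<open>p\<^sup>2\<close>.\<close>
  have scale: "cmod (?c r * z) \<le> K\<^sup>2 * (c * N)" if "cmod z \<le> c * ?P" "real p * \<bar>r\<bar> \<le> N" "0 \<le> c" for r z c N
  proof -
    have "cmod (?c r * z) \<le> \<bar>r\<bar> * (c * ?P)"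
      using that by (simp add: norm_mult mult_left_mono)
    also have "\<dots> = K\<^sup>2 * (c * (real p * \<bar>r\<bar>))" by (simp add: mult_ac)
    also have "\<dots> \<le> K\<^sup>2 * (c * N)"
      using that by (intro mult_left_mono) auto
    finally show ?thesis .
  qed
  have scale2: "cmod (?c r * z) \<le> K\<^sup>2 * (c * N)"
    if "cmod z \<le> c * (?P * real p)" "(real p)\<^sup>2 * \<bar>r\<bar> \<le> N" "0 \<le> c" for r z c N
  proof -
    have "cmod (?c r * z) \<le> \<bar>r\<bar> * (c * (?P * real p))"
      using that by (simp add: norm_mult mult_left_mono)
    also have "\<dots> = K\<^sup>2 * (c * ((real p)\<^sup>2 * \<bar>r\<bar>))" by (simp add: power2_eq_square mult_ac)
    also have "\<dots> \<le> K\<^sup>2 * (c * N)"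
      using that by (intro mult_left_mono) auto
    finally show ?thesis .
  qed
  let ?\<Delta> = "\<bar>m22 - m2\<^sup>2\<bar>"
  have "cmod (?c (a_coeff - (m4 - 3 * m22)) * D + ?c (b_coeff - m22) * F + ?c c_coeff * T + ?c e_coeff * R
      + ?c m1111 * (sA * sB - tA * tB) + ?c g * (tA * sB + sA * tB - 2 * tA * tB))
    \<le> K\<^sup>2 * (1 * (128 * m4)) + K\<^sup>2 * (2 * (20 * m4)) + K\<^sup>2 * (4 * (38 * m4)) + K\<^sup>2 * (4 * (16 * m4))
      + K\<^sup>2 * (2 * (48 * m4)) + K\<^sup>2 * (4 * (54 * m4 + 2 * real p * ?\<Delta>))"
    using cb nD nF nT nR nS nG
    by (intro norm_triangle_mono scale[of D 1] scale[of F 2] scale[of T 4] scale[of R 4]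
      scale2[of "sA * sB - tA * tB" 2] scale2[of "tA * sB + sA * tB - 2 * tA * tB" 4])
      (simp_all only: g_def mult_1 zero_le_numeral zero_le_one)
  also have "\<dots> = K\<^sup>2 * (696 * m4 + 8 * real p * ?\<Delta>)"
    by (simp add: algebra_simps)
  finally show ?thesis
    by (fold eq) (simp only: D_def F_def tA_def tB_def)
qed

text \<open>The mean \<open>S\<close> of the squares has expectation \<open>m2\<close> and second
  moment \<open>m22 + (m4 - m22) / p\<close>. Its variance is at most its mean squared distance from
  any constant \<open>s\<close>, so \<open>s\<close> can later be taken as the limit of
  \<open>S\<close>.\<close>

lemma abs_m22_minus_m2_square_le:
  assumes p: "2 \<le> p"
  shows "\<bar>m22 - m2\<^sup>2\<bar> \<le> expectation (\<lambda>x. ((\<Sum>i<p. (d i x)\<^sup>2) / real p - s)\<^sup>2) + m4 / real p"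
proof -
  define S where "S x = (\<Sum>i<p. (d i x)\<^sup>2) / real p" for x
  have d22: "has_bochner_integral M (\<lambda>x. (d i x)\<^sup>2 * (d j x)\<^sup>2) (if i = j then m4 else m22)" if "i < p" "j < p" for i j
    using that mom4_diag[of i] mom4_cases(5)[of i j]
      integrable_prod_list[of "[i, i, i, i]"] integrable_prod_list[of "[i, i, j, j]"]
    by (auto simp: has_bochner_integral_iff mom_def power2_eq_square mult.assoc)
  have d2: "has_bochner_integral M (\<lambda>x. (d i x)\<^sup>2) m2" if "i < p" for i
    using that p mom2[of i i] by (simp add: has_bochner_integral_iff mom_def power2_eq_square)
  have "has_bochner_integral M S ((\<Sum>i<p. m2) / real p)"
    unfolding S_def by (intro has_bochner_integral_divide has_bochner_integral_sum d2) auto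
  then have S: "has_bochner_integral M S m2"
    using p by simp
  have "has_bochner_integral M (\<lambda>x. (\<Sum>i<p. \<Sum>j<p. (d i x)\<^sup>2 * (d j x)\<^sup>2) / (real p)\<^sup>2)
      ((\<Sum>i<p. \<Sum>j<p. if i = j then m4 else m22) / (real p)\<^sup>2)"
    by (intro has_bochner_integral_divide has_bochner_integral_sum d22) auto
  moreover have "(\<Sum>j<p. if i = j then m4 else m22) = m4 + (real p - 1) * m22" if "i < p" for i
    using that p sum.remove[of "{..<p}" i "\<lambda>j. if i = j then m4 else m22"]
    by (simp add: of_nat_diff)
  ultimately have S2: "has_bochner_integral M (\<lambda>x. (S x)\<^sup>2) ((m4 + (real p - 1) * m22) / real p)"
    using p by (simp add: S_def power2_eq_square sum_product)
  have var: "expectation (\<lambda>x. (S x - t)\<^sup>2) = (m4 + (real p - 1) * m22) / real p - 2 * t * m2 + t\<^sup>2" for t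
  proof -
    have "has_bochner_integral M (\<lambda>x. (S x)\<^sup>2 - 2 * t * S x + t\<^sup>2)
        ((m4 + (real p - 1) * m22) / real p - 2 * t * m2 + t\<^sup>2)"
      by (intro has_bochner_integral_add has_bochner_integral_diff has_bochner_integral_mult_right S S2)
         (simp add: has_bochner_integral_iff prob_space)
    then show ?thesis
      by (simp add: has_bochner_integral_iff power2_diff algebra_simps)
  qed
  define X where "X = (m4 + (real p - 1) * m22) / real p"
  have "0 \<le> expectation (\<lambda>x. (S x - m2)\<^sup>2)" by simp
  then have "m2\<^sup>2 \<le> X"
    unfolding var by (simp add: X_def power2_eq_square)
  moreover have "0 \<le> (m2 - s)\<^sup>2" by simp
  then have "X - m2\<^sup>2 \<le> expectation (\<lambda>x. (S x - s)\<^sup>2)"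
    unfolding var by (simp add: X_def power2_eq_square algebra_simps)
  moreover have "X = m22 + m4 / real p - m22 / real p"
    using p by (simp add: X_def field_simps)
  moreover have "m22 / real p \<le> m4 / real p" "0 \<le> m22 / real p"
    using m22_le_m4[OF p] m22_nonneg by (auto intro: divide_right_mono)
  moreover have "0 \<le> expectation (\<lambda>x. (S x - s)\<^sup>2)"
    by simp
  ultimately have "\<bar>m22 - m2\<^sup>2\<bar> \<le> expectation (\<lambda>x. (S x - s)\<^sup>2) + m4 / real p"
    unfolding abs_le_iff by linarith
  then show ?thesis
    by (simp only: S_def)
qed

end

section \<open>Normalised independent positive weights\<close>

lemma power2_add_le: "(a + b)\<^sup>2 \<le> 2 * a\<^sup>2 + 2 * b\<^sup>2" for a b :: real
  using zero_le_power2[of "a - b"] by (simp add: power2_eq_square algebra_simps)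

text \<open>From \<open>(1 - x + x\<^sup>2) * (1 + x) = 1 + x ^ 3 \<ge> 1\<close> and
  \<open>1 + x \<le> exp x\<close>. For positive weights it bounds the Laplace transform by two
  moments.\<close>

lemma exp_minus_le:
  fixes x :: real
  assumes "0 \<le> x"
  shows "exp (- x) \<le> 1 - x + x\<^sup>2"
proof -
  have "1 \<le> (1 - x + x\<^sup>2) * (1 + x)"
    using assms by (simp add: algebra_simps power2_eq_square)
  also have "\<dots> \<le> (1 - x + x\<^sup>2) * exp x"
    using zero_le_power2[of "x - 1/2"]
    by (intro mult_left_mono exp_ge_add_one_self) (simp add: power2_eq_square algebra_simps)
  finally show ?thesis
    by (simp add: exp_minus field_simps)
qed

text \<open>The fourth moment is taken raw, which is the form the truncation estimates use; the
  theorem's central moment is converted once.\<close>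

locale iid_positive = prob_space M for M :: "'a measure" +
  fixes w :: "nat \<Rightarrow> 'a \<Rightarrow> real" and \<mu> :: real
  assumes indep: "indep_vars (\<lambda>_. borel) w UNIV"
    and ident: "\<And>i. distr M borel (w i) = distr M borel (w 0)"
    and pos: "\<And>i. AE x in M. w i x > 0"
    and mean: "expectation (w 0) = \<mu>" "\<mu> > 0"
    and fourth: "integrable M (\<lambda>x. w 0 x ^ 4)"
begin

lemma measurable_w [measurable]: "w i \<in> borel_measurable M"
  using indep by (simp add: indep_vars_def)

lemma pos_all: "AE x in M. \<forall>i. w i x > 0"
  using pos by (simp add: AE_all_countable)

lemma has_bochner_integral_w:
  fixes g :: "real \<Rightarrow> real"
  assumes g [measurable]: "g \<in> borel_measurable borel" and "integrable M (\<lambda>x. g (w 0 x))"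
  shows "has_bochner_integral M (\<lambda>x. g (w i x)) (expectation (\<lambda>x. g (w 0 x)))"
proof -
  have "integrable M (\<lambda>x. g (w i x))"
    using assms(2) integrable_distr_eq[of "w i" M borel g] integrable_distr_eq[of "w 0" M borel g] ident[of i]
    by simp
  moreover have "expectation (\<lambda>x. g (w i x)) = expectation (\<lambda>x. g (w 0 x))"
    using integral_distr[of "w i" M borel g] integral_distr[of "w 0" M borel g] ident[of i] by simp
  ultimately show ?thesis
    by (simp add: has_bochner_integral_iff)
qed

lemma integrable_power:
  assumes "k \<le> 4"
  shows "integrable M (\<lambda>x. w 0 x ^ k)"
proof (rule Bochner_Integration.integrable_bound)
  show "integrable M (\<lambda>x. 1 + w 0 x ^ 4)"
    using fourth by simp
  have "\<bar>y\<bar> ^ k \<le> 1 + \<bar>y\<bar> ^ 4" for y :: real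
  proof (cases "\<bar>y\<bar> \<le> 1")
    case True
    then have "\<bar>y\<bar> ^ k \<le> 1" by (simp add: power_le_one)
    then show ?thesis by (simp add: add_increasing2)
  next
    case False
    then have "\<bar>y\<bar> ^ k \<le> \<bar>y\<bar> ^ 4" using assms by (intro power_increasing) auto
    then show ?thesis by simp
  qed
  then show "AE x in M. norm (w 0 x ^ k) \<le> norm (1 + w 0 x ^ 4)"
    by (simp add: power_abs)
qed simp

text \<open>By independence and equal marginals the joint law of the first \<open>p\<close> weights
  is a power of one measure, which is invariant under permuting coordinates. The restrictions to
  \<open>{..<p}\<close> keep the vectors inside the product space.\<close>

lemma expectation_permute:
  fixes F :: "(nat \<Rightarrow> real) \<Rightarrow> real"
  assumes "0 < p" and \<pi>: "bij_betw \<pi> {..<p} {..<p}"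
    and F [measurable]: "F \<in> borel_measurable (\<Pi>\<^sub>M i\<in>{..<p}. borel)"
  shows "expectation (\<lambda>x. F (\<lambda>i\<in>{..<p}. w (\<pi> i) x)) = expectation (\<lambda>x. F (\<lambda>i\<in>{..<p}. w i x))"
proof -
  define P where "P = (\<Pi>\<^sub>M i\<in>{..<p}. (borel :: real measure))"
  define D where "D = (\<Pi>\<^sub>M i\<in>{..<p}. distr M borel (w 0))"
  have [measurable]: "F \<in> borel_measurable P"
    using F by (simp add: P_def)
  have DP [measurable_cong]: "sets D = sets P"
    unfolding D_def P_def by (intro sets_PiM_cong) auto
  have \<pi>_in: "\<pi> i \<in> {..<p}" if "i < p" for i
    using \<pi> that by (auto simp: bij_betw_def)
  have r [measurable]: "(\<lambda>v. \<lambda>i\<in>{..<p}. v (\<pi> i)) \<in> measurable P P"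
    unfolding P_def by (intro measurable_restrict measurable_component_singleton \<pi>_in) auto
  have W [measurable]: "(\<lambda>x. \<lambda>i\<in>{..<p}. w i x) \<in> measurable M P"
    unfolding P_def by (intro measurable_restrict) simp
  have law: "distr M P (\<lambda>x. \<lambda>i\<in>{..<p}. w i x) = D"
  proof -
    have "distr M P (\<lambda>x. \<lambda>i\<in>{..<p}. w i x) = (\<Pi>\<^sub>M i\<in>{..<p}. distr M borel (w i))"
      using indep_vars_iff_distr_eq_PiM'[of "{..<p}" w "\<lambda>_. borel"] indep_vars_subset[OF indep, of "{..<p}"] \<open>0 < p\<close>
      by (auto simp: P_def)
    also have "\<dots> = D"
      unfolding D_def by (intro PiM_cong refl ident)
    finally show ?thesis .
  qed
  \<comment> \<open>\<open>D\<close> and \<open>P\<close> have the same sigma-algebra; the target is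
    exchanged because the reindexing rule for product measures has \<open>D\<close> on both
    sides.\<close>
  have "distr D P (\<lambda>v. \<lambda>i\<in>{..<p}. v (\<pi> i)) = distr D D (\<lambda>v. \<lambda>i\<in>{..<p}. v (\<pi> i))"
    by (intro distr_cong) (simp_all add: DP)
  also have "\<dots> = D"
    unfolding D_def using \<pi> \<pi>_in
    by (intro distr_PiM_reindex) (auto simp: bij_betw_def intro!: prob_space_distr)
  finally have perm: "distr D P (\<lambda>v. \<lambda>i\<in>{..<p}. v (\<pi> i)) = D" .
  have "expectation (\<lambda>x. F (\<lambda>i\<in>{..<p}. w (\<pi> i) x)) = expectation (\<lambda>x. F (\<lambda>i\<in>{..<p}. (\<lambda>j\<in>{..<p}. w j x) (\<pi> i)))"
    using \<pi>_in by (intro Bochner_Integration.integral_cong refl arg_cong[where f = F]) (auto simp: fun_eq_iff)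
  also have "\<dots> = (\<integral>v. F (\<lambda>i\<in>{..<p}. v (\<pi> i)) \<partial>D)"
    unfolding law[symmetric] by (subst integral_distr) auto
  also have "\<dots> = (\<integral>v. F v \<partial>distr D P (\<lambda>v. \<lambda>i\<in>{..<p}. v (\<pi> i)))"
    by (subst integral_distr) auto
  also have "\<dots> = expectation (\<lambda>x. F (\<lambda>i\<in>{..<p}. w i x))"
    unfolding perm unfolding law[symmetric] by (subst integral_distr) auto
  finally show ?thesis .
qed

section \<open>Exchangeability and concentration for the normalised weights\<close>

lemma measurable_wdev [measurable]: "wdev w p i \<in> borel_measurable M"
  unfolding wdev_def[abs_def] wbar_def by measurable

lemma wdev_bounds:
  assumes "\<forall>i. w i x > 0" "i < p"
  shows "wbar w p x > 0" "-1 < wdev w p i x" "\<bar>wdev w p i x\<bar> \<le> real p"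
proof -
  have le: "w i x \<le> (\<Sum>j<p. w j x)"
    using assms by (intro member_le_sum) (auto intro: less_imp_le)
  moreover have wi: "w i x > 0" using assms by simp
  ultimately show "wbar w p x > 0"
    using assms(2) by (simp add: wbar_def)
  then show "-1 < wdev w p i x"
    using wi by (simp add: wdev_def)
  have "w i x / wbar w p x \<le> real p"
    using mult_left_mono[OF le, of "real p"] le wi by (simp add: wbar_def divide_le_eq mult.commute)
  then show "\<bar>wdev w p i x\<bar> \<le> real p"
    using \<open>-1 < wdev w p i x\<close> assms(2) by (auto simp: wdev_def abs_le_iff)
qed

text \<open>The mean is symmetric in the weights, so permuting the weights permutes the deviations.
  A product of deviations is therefore a measurable function \<open>F\<close> of the weight vector
  to which \<open>expectation_permute\<close> applies.\<close>

lemma exchangeable_wdev: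
  assumes "0 < p"
  shows "exchangeable_zero_sum M (wdev w p) p (real p)"
proof
  show "AE x in M. \<bar>wdev w p i x\<bar> \<le> real p" if "i < p" for i
    using pos_all by eventually_elim (use that in \<open>simp add: wdev_bounds\<close>)
  show "AE x in M. (\<Sum>i<p. wdev w p i x) = 0"
    using pos_all
  proof eventually_elim
    case (elim x)
    then have "wbar w p x > 0"
      using wdev_bounds(1)[of x 0 p] assms by simp
    moreover have "(\<Sum>i<p. w i x) = real p * wbar w p x"
      using assms by (simp add: wbar_def)
    ultimately show ?case
      by (simp add: wdev_def sum_subtractf flip: sum_divide_distrib)
  qed
  fix \<pi> :: "nat \<Rightarrow> nat" and xs
  assume \<pi>: "bij_betw \<pi> {..<p} {..<p}" and xs: "set xs \<subseteq> {..<p}"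
  define F where "F v = (\<Prod>i\<leftarrow>xs. v i / ((\<Sum>j<p. v j) / real p) - 1)" for v :: "nat \<Rightarrow> real"
  have F: "F \<in> borel_measurable (\<Pi>\<^sub>M i\<in>{..<p}. borel)"
    using xs unfolding F_def[abs_def]
  proof (induction xs)
    case (Cons a xs)
    then have [measurable]: "a \<in> {..<p}"
      "(\<lambda>v. \<Prod>i\<leftarrow>xs. v i / ((\<Sum>j<p. v j) / real p) - 1) \<in> borel_measurable (\<Pi>\<^sub>M i\<in>{..<p}. borel)"
      by auto
    have "(\<lambda>v. (v a / ((\<Sum>j<p. v j) / real p) - 1) * (\<Prod>i\<leftarrow>xs. v i / ((\<Sum>j<p. v j) / real p) - 1))
        \<in> borel_measurable (\<Pi>\<^sub>M i\<in>{..<p}. borel)"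
      by measurable
    then show ?case
      by (simp only: list.map prod_list.Cons)
  qed simp
  have 1: "F (\<lambda>i\<in>{..<p}. w (\<pi> i) x) = (\<Prod>i\<leftarrow>map \<pi> xs. wdev w p i x)" for x
  proof -
    have "(\<Sum>j<p. w (\<pi> j) x) = (\<Sum>j<p. w j x)"
      by (rule sum.reindex_bij_betw[OF \<pi>])
    then show ?thesis
      using xs by (auto simp: F_def wdev_def wbar_def intro!: arg_cong[where f = prod_list])
  qed
  have 2: "F (\<lambda>i\<in>{..<p}. w i x) = (\<Prod>i\<leftarrow>xs. wdev w p i x)" for x
    using xs by (auto simp: F_def wdev_def wbar_def intro!: arg_cong[where f = prod_list])
  show "expectation (\<lambda>x. \<Prod>i\<leftarrow>map \<pi> xs. wdev w p i x) = expectation (\<lambda>x. \<Prod>i\<leftarrow>xs. wdev w p i x)"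
    using expectation_permute[OF assms \<pi> F] by (simp only: 1 2)
qed simp

text \<open>After centring, only the \<open>p\<close> diagonal terms of the double sum survive. It
  is applied to the weights and to their squares.\<close>

lemma variance_of_mean:
  fixes g :: "real \<Rightarrow> real"
  assumes g [measurable]: "g \<in> borel_measurable borel"
    and int: "integrable M (\<lambda>x. g (w 0 x))" "integrable M (\<lambda>x. (g (w 0 x))\<^sup>2)" and "0 < p"
  defines "m \<equiv> expectation (\<lambda>x. g (w 0 x))"
  shows "has_bochner_integral M (\<lambda>x. ((\<Sum>i<p. g (w i x)) / real p - m)\<^sup>2)
    (expectation (\<lambda>x. (g (w 0 x) - m)\<^sup>2) / real p)"
proof -
  define Y where "Y i x = g (w i x) - m" for i x
  define V where "V = expectation (\<lambda>x. (Y 0 x)\<^sup>2)"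
  have ind: "indep_vars (\<lambda>_. borel) Y UNIV"
    unfolding Y_def[abs_def] using indep_vars_compose2[OF indep, of "\<lambda>_ y. g y - m" "\<lambda>_. borel"] by simp
  have Y0: "has_bochner_integral M (Y i) 0" for i
    using has_bochner_integral_w[of "\<lambda>y. g y - m" i] int(1)
    by (simp add: Y_def[abs_def] m_def prob_space)
  have "integrable M (\<lambda>x. (g (w 0 x))\<^sup>2 - 2 * m * g (w 0 x) + m\<^sup>2)"
    using int by simp
  then have "integrable M (\<lambda>x. (Y 0 x)\<^sup>2)"
    by (simp add: Y_def power2_diff algebra_simps)
  then have Y2: "has_bochner_integral M (\<lambda>x. (Y i x)\<^sup>2) V" for i
    using has_bochner_integral_w[of "\<lambda>y. (g y - m)\<^sup>2" i] by (simp add: Y_def V_def)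
  have YY: "has_bochner_integral M (\<lambda>x. Y i x * Y j x) (if i = j then V else 0)" for i j
  proof (cases "i = j")
    case True
    then show ?thesis using Y2[of i] by (simp add: power2_eq_square)
  next
    case False
    have I: "indep_vars (\<lambda>_. borel) Y {i, j}"
      using ind by (rule indep_vars_subset) simp
    have Yint: "integrable M (Y k)" "expectation (Y k) = 0" for k
      using Y0 by (auto simp: has_bochner_integral_iff)
    show ?thesis
      using False indep_vars_lebesgue_integral[OF _ I] indep_vars_integrable[OF _ I] Yint
      by (simp add: has_bochner_integral_iff)
  qed
  have "has_bochner_integral M (\<lambda>x. (\<Sum>i<p. \<Sum>j<p. Y i x * Y j x) / (real p)\<^sup>2)
      ((\<Sum>i<p. \<Sum>j<p. if i = j then V else 0) / (real p)\<^sup>2)"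
    by (intro has_bochner_integral_divide has_bochner_integral_sum YY)
  moreover have "(\<Sum>i<p. \<Sum>j<p. Y i x * Y j x) / (real p)\<^sup>2 = ((\<Sum>i<p. g (w i x)) / real p - m)\<^sup>2" for x
  proof -
    have "(\<Sum>i<p. g (w i x)) / real p - m = (\<Sum>i<p. Y i x) / real p"
      using \<open>0 < p\<close> by (simp add: Y_def sum_subtractf diff_divide_distrib)
    then show ?thesis
      by (simp add: power_divide power2_eq_square sum_product)
  qed
  ultimately show ?thesis
    using \<open>0 < p\<close> by (simp add: V_def Y_def power2_eq_square)
qed

text \<open>An exponential rate is needed: on this event only \<open>\<bar>wdev w p i x\<bar> \<le> p\<close> is available. Positivity of the
weights provides it by a Chernoff bound without any exponential moments.\<close>

lemma small_mean_prob:
  obtains \<rho> where "0 < \<rho>" "\<rho> < 1" "\<And>p. 0 < p \<Longrightarrow> prob {x \<in> space M. wbar w p x \<le> \<mu> / 2} \<le> \<rho> ^ p"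
proof -
  define q where "q = expectation (\<lambda>x. (w 0 x)\<^sup>2)"
  have int: "integrable M (w 0)" "integrable M (\<lambda>x. (w 0 x)\<^sup>2)"
    using integrable_power[of 1] integrable_power[of 2] by simp_all
  have "0 \<le> variance (w 0)" by (rule variance_positive)
  then have "\<mu>\<^sup>2 \<le> q"
    using int variance_eq[of "w 0"] by (simp only: mean(1) q_def)
  moreover have "0 < \<mu>\<^sup>2" using mean(2) by simp
  ultimately have q: "q > 0" by linarith
  \<comment> \<open>This \<open>t\<close> minimises the Chernoff exponent
    \<open>- t * \<mu> / 2 + t\<^sup>2 * q\<close> per weight; its value there is
    \<open>- t * \<mu> / 4\<close>, so \<rho> < 1.\<close>
  define t where "t = \<mu> / (4 * q)"
  have t: "t > 0" using q mean(2) by (simp add: t_def)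
  define \<rho> where "\<rho> = exp (t * \<mu> / 2 - t * \<mu> + t\<^sup>2 * q)"
  have e_int: "integrable M (\<lambda>x. exp (- t * w i x))" for i
  proof (rule integrable_const_bound[where B = 1])
    show "AE x in M. norm (exp (- t * w i x)) \<le> 1"
      using pos[of i] by eventually_elim (use t in simp)
  qed simp
  have "expectation (\<lambda>x. exp (- t * w 0 x)) \<le> expectation (\<lambda>x. 1 - t * w 0 x + t\<^sup>2 * (w 0 x)\<^sup>2)"
  proof (intro integral_mono_AE e_int)
    show "AE x in M. exp (- t * w 0 x) \<le> 1 - t * w 0 x + t\<^sup>2 * (w 0 x)\<^sup>2"
      using pos[of 0] by eventually_elim (use t exp_minus_le[of "t * w 0 _"] in \<open>simp add: power_mult_distrib\<close>)
  qed (use int in simp)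
  also have "\<dots> = 1 + (- t * \<mu> + t\<^sup>2 * q)"
    using int by (simp add: prob_space mean(1) q_def)
  also have "\<dots> \<le> exp (- t * \<mu> + t\<^sup>2 * q)"
    by (rule exp_ge_add_one_self)
  finally have E0: "expectation (\<lambda>x. exp (- t * w 0 x)) \<le> exp (- t * \<mu> + t\<^sup>2 * q)" .
  have E: "expectation (\<lambda>x. exp (- t * w i x)) = expectation (\<lambda>x. exp (- t * w 0 x))" for i
    using has_bochner_integral_w[of "\<lambda>y. exp (- t * y)" i] e_int[of 0] by (simp add: has_bochner_integral_iff)
  show thesis
  proof (rule that)
    show "0 < \<rho>" by (simp add: \<rho>_def)
    have "t * q = \<mu> / 4"
      using q by (simp add: t_def)
    then have "t\<^sup>2 * q = t * (\<mu> / 4)"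
      by (simp only: power2_eq_square mult.assoc)
    then have "t * \<mu> / 2 - t * \<mu> + t\<^sup>2 * q = - (t * \<mu> / 4)"
      by (simp add: field_simps)
    also have "\<dots> < 0"
      using t mean(2) by simp
    finally show "\<rho> < 1"
      by (simp add: \<rho>_def)
    fix p :: nat assume p: "0 < p"
    have ind: "indep_vars (\<lambda>_. borel) (\<lambda>i x. exp (- t * w i x)) {..<p}"
      using indep_vars_compose2[OF indep_vars_subset[OF indep, of "{..<p}"], of "\<lambda>_ y. exp (- t * y)" "\<lambda>_. borel"] by simp
    have Z: "(\<Prod>i<p. exp (- t * w i x)) = exp (- t * (real p * wbar w p x))" for x
    proof -
      have "real p * wbar w p x = (\<Sum>i<p. w i x)"
        using p by (simp add: wbar_def)
      then show ?thesis
        by (simp only: sum_distrib_left exp_sum finite_lessThan)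
    qed
    have prod_int: "integrable M (\<lambda>x. \<Prod>i<p. exp (- t * w i x))"
      by (rule indep_vars_integrable[OF finite_lessThan ind e_int])
    have "prob {x \<in> space M. wbar w p x \<le> \<mu> / 2}
        = prob {x \<in> space M. (\<Prod>i<p. exp (- t * w i x)) \<ge> exp (- t * (real p * (\<mu> / 2)))}"
      unfolding Z using t p by (intro arg_cong[where f = prob] Collect_cong conj_cong refl) simp
    also have "\<dots> \<le> expectation (\<lambda>x. \<Prod>i<p. exp (- t * w i x)) / exp (- t * (real p * (\<mu> / 2)))"
      by (rule integral_Markov_inequality_measure[where A = "{}"])
         (use prod_int in \<open>auto intro!: prod_nonneg\<close>)
    also have "expectation (\<lambda>x. \<Prod>i<p. exp (- t * w i x)) = expectation (\<lambda>x. exp (- t * w 0 x)) ^ p"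
      unfolding indep_vars_lebesgue_integral[OF finite_lessThan ind e_int]
      by (subst prod.cong[OF refl E]) simp
    also have "\<dots> \<le> exp (- t * \<mu> + t\<^sup>2 * q) ^ p"
      by (intro power_mono E0) simp
    also have "exp (- t * \<mu> + t\<^sup>2 * q) ^ p / exp (- t * (real p * (\<mu> / 2))) = \<rho> ^ p"
    proof -
      have "real p * (- t * \<mu> + t\<^sup>2 * q) - (- t * (real p * (\<mu> / 2))) = real p * (t * \<mu> / 2 - t * \<mu> + t\<^sup>2 * q)"
        by (simp add: algebra_simps)
      then show ?thesis
        by (simp only: \<rho>_def exp_of_nat_mult[symmetric] exp_diff[symmetric])
    qed
    finally show "prob {x \<in> space M. wbar w p x \<le> \<mu> / 2} \<le> \<rho> ^ p"
      by (simp add: divide_right_mono)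
  qed
qed

text \<open>Where the mean exceeds \<open>\<mu> / 2\<close>, the fourth power is at most
  \<open>1 + (2 * w 0 x / \<mu>) ^ 4\<close>. The exceptional event contributes at most
  \<open>p ^ 4 * \<rho> ^ p\<close>, a null sequence and hence bounded.\<close>

lemma nu4_bounded:
  obtains C where "\<And>p. 0 < p \<Longrightarrow> \<nu>4 M w p \<le> C"
proof -
  obtain \<rho> where \<rho>: "0 < \<rho>" "\<rho> < 1" "\<And>p. 0 < p \<Longrightarrow> prob {x \<in> space M. wbar w p x \<le> \<mu> / 2} \<le> \<rho> ^ p"
    by (rule small_mean_prob) blast
  define W where "W = expectation (\<lambda>x. w 0 x ^ 4)"
  have bound: "\<nu>4 M w p \<le> 1 + 16 / \<mu> ^ 4 * W + real p ^ 4 * \<rho> ^ p" if p: "0 < p" for p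
  proof -
    define E where "E = {x \<in> space M. wbar w p x \<le> \<mu> / 2}"
    have [measurable]: "E \<in> sets M"
      unfolding E_def wbar_def by measurable
    interpret ex: exchangeable_zero_sum M "wdev w p" p "real p"
      by (rule exchangeable_wdev[OF p])
    have "\<nu>4 M w p \<le> expectation (\<lambda>x. 1 + 16 / \<mu> ^ 4 * w 0 x ^ 4 + real p ^ 4 * indicator E x)"
      unfolding \<nu>4_def
    proof (rule integral_mono_AE)
      show "AE x in M. wdev w p 0 x ^ 4 \<le> 1 + 16 / \<mu> ^ 4 * w 0 x ^ 4 + real p ^ 4 * indicator E x"
        using pos_all AE_space
      proof eventually_elim
        case (elim x)
        note wb = wdev_bounds[OF elim(1) p]
        have nonneg: "0 \<le> 16 / \<mu> ^ 4 * w 0 x ^ 4" by simp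
        show ?case
        proof (cases "x \<in> E")
          case True
          have "wdev w p 0 x ^ 4 \<le> real p ^ 4"
            using power_mono[OF wb(3), of 4] by (simp add: power_even_abs)
          moreover have "indicator E x = (1 :: real)"
            using True by simp
          ultimately show ?thesis
            using nonneg by (simp only: mult_1_right)
        next
          case False
          then have large: "\<mu> / 2 < wbar w p x"
            using elim(2) by (simp add: E_def)
          define y where "y = w 0 x / wbar w p x"
          have y0: "0 \<le> y"
            using elim(1)[rule_format, of 0] wb(1) by (simp add: y_def)
          have "y \<le> w 0 x / (\<mu> / 2)"
            unfolding y_def using elim(1)[rule_format, of 0] mean(2) large
            by (intro divide_left_mono mult_pos_pos) auto
          then have "y ^ 4 \<le> (w 0 x / (\<mu> / 2)) ^ 4"
            using y0 by (intro power_mono)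
          also have "\<dots> = 16 / \<mu> ^ 4 * w 0 x ^ 4"
            by (simp add: power_divide power_mult_distrib)
          finally have "y ^ 4 \<le> 16 / \<mu> ^ 4 * w 0 x ^ 4" .
          \<comment> \<open>For \<open>y \<ge> 0\<close> the left side is at most 1 or at most
            \<open>y ^ 4\<close>, depending on the side of 1 on which \<open>y\<close> lies.\<close>
          moreover have "(y - 1) ^ 4 \<le> 1 + y ^ 4"
          proof (cases "y \<le> 1")
            case True
            then have "(1 - y) ^ 4 \<le> 1"
              using y0 by (intro power_le_one) auto
            moreover have "(y - 1) ^ 4 = (1 - y) ^ 4"
              by (simp add: power4_eq_xxxx algebra_simps)
            moreover have "0 \<le> y ^ 4" by simp
            ultimately show ?thesis by linarith
          next
            case False
            then have "(y - 1) ^ 4 \<le> y ^ 4"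
              by (intro power_mono) auto
            then show ?thesis by simp
          qed
          ultimately show ?thesis
            using False by (simp add: wdev_def y_def)
        qed
      qed
      show "integrable M (\<lambda>x. 1 + 16 / \<mu> ^ 4 * w 0 x ^ 4 + real p ^ 4 * indicator E x)"
        by (intro Bochner_Integration.integrable_add integrable_mult_right fourth) (simp_all add: less_top[symmetric])
    qed (use p in simp)
    also have "\<dots> = 1 + 16 / \<mu> ^ 4 * W + real p ^ 4 * prob E"
    proof -
      have "integrable M (indicator E :: 'a \<Rightarrow> real)"
        by (simp add: less_top[symmetric])
      then show ?thesis
        using fourth by (simp add: W_def prob_space)
    qed
    also have "\<dots> \<le> 1 + 16 / \<mu> ^ 4 * W + real p ^ 4 * \<rho> ^ p"
      using \<rho>(3)[OF p] by (simp add: E_def mult_left_mono)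
    finally show ?thesis .
  qed
  have "(\<lambda>p. real p ^ 4 * \<rho> ^ p) \<longlonglongrightarrow> 0"
    using \<rho>(1,2) by real_asymp
  then have "Bseq (\<lambda>p. real p ^ 4 * \<rho> ^ p)"
    by (intro convergent_imp_Bseq convergentI)
  then obtain c where "\<And>p. norm (real p ^ 4 * \<rho> ^ p) \<le> c"
    by (auto simp: Bseq_def)
  then have "\<nu>4 M w p \<le> 1 + 16 / \<mu> ^ 4 * W + c" if "0 < p" for p
    using bound[OF that] by (smt (verit) real_norm_def)
  then show thesis by (rule that)
qed

lemma nu12_minus_nu2_square:
  "(\<lambda>p. \<nu>12 M w p - (\<nu>2 M w p)\<^sup>2) \<longlonglongrightarrow> 0"
proof -
  obtain \<rho> where \<rho>: "0 < \<rho>" "\<rho> < 1" "\<And>p. 0 < p \<Longrightarrow> prob {x \<in> space M. wbar w p x \<le> \<mu> / 2} \<le> \<rho> ^ p"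
    by (rule small_mean_prob) blast
  obtain C where C: "\<And>p. 0 < p \<Longrightarrow> \<nu>4 M w p \<le> C"
    by (rule nu4_bounded) blast
  have int: "integrable M (w 0)" "integrable M (\<lambda>x. (w 0 x)\<^sup>2)"
    using integrable_power[of 1] integrable_power[of 2] by simp_all
  define q where "q = expectation (\<lambda>x. (w 0 x)\<^sup>2)"
  define V1 where "V1 = expectation (\<lambda>x. (w 0 x - \<mu>)\<^sup>2)"
  define V2 where "V2 = expectation (\<lambda>x. ((w 0 x)\<^sup>2 - q)\<^sup>2)"
  \<comment> \<open>By the law of large numbers this is the limit of the mean squared deviation,
    since that mean equals the mean of the squared weights divided by \<open>wbar\<^sup>2\<close>,
    minus 1.\<close>
  define s where "s = q / \<mu>\<^sup>2 - 1"
  have q: "0 \<le> q" by (simp add: q_def)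
  have bound: "\<bar>\<nu>12 M w p - (\<nu>2 M w p)\<^sup>2\<bar> \<le>
      32 / \<mu> ^ 4 * (V2 / real p) + 72 * q\<^sup>2 / \<mu> ^ 6 * (V1 / real p) + (2 * real p ^ 4 + 2 * s\<^sup>2) * \<rho> ^ p + C / real p"
    if p: "2 \<le> p" for p
  proof -
    have p0: "0 < p" using p by simp
    define E where "E = {x \<in> space M. wbar w p x \<le> \<mu> / 2}"
    have [measurable]: "E \<in> sets M"
      unfolding E_def wbar_def by measurable
    interpret ex: exchangeable_zero_sum M "wdev w p" p "real p"
      by (rule exchangeable_wdev[OF p0])
    define Q where "Q x = (\<Sum>i<p. (w i x)\<^sup>2) / real p" for x
    define S where "S x = (\<Sum>i<p. (wdev w p i x)\<^sup>2) / real p" for x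
    have [measurable]: "S \<in> borel_measurable M"
      unfolding S_def[abs_def] by measurable
    have Qv: "has_bochner_integral M (\<lambda>x. (Q x - q)\<^sup>2) (V2 / real p)"
      using variance_of_mean[of "\<lambda>y. y\<^sup>2" p] int fourth p0
      by (simp add: Q_def q_def V2_def flip: power_mult)
    have wv: "has_bochner_integral M (\<lambda>x. (wbar w p x - \<mu>)\<^sup>2) (V1 / real p)"
      using variance_of_mean[of "\<lambda>y. y" p] int p0
      by (simp add: wbar_def mean(1) V1_def)
    define R where "R x = 32 / \<mu> ^ 4 * (Q x - q)\<^sup>2 + 72 * q\<^sup>2 / \<mu> ^ 6 * (wbar w p x - \<mu>)\<^sup>2
      + (2 * real p ^ 4 + 2 * s\<^sup>2) * indicator E x" for x
    have R: "has_bochner_integral M R (32 / \<mu> ^ 4 * (V2 / real p) + 72 * q\<^sup>2 / \<mu> ^ 6 * (V1 / real p)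
      + (2 * real p ^ 4 + 2 * s\<^sup>2) * prob E)"
      unfolding R_def[abs_def]
      by (intro has_bochner_integral_add has_bochner_integral_mult_right Qv wv)
         (simp add: has_bochner_integral_iff less_top[symmetric])
    have le: "AE x in M. (S x - s)\<^sup>2 \<le> R x"
      using pos_all AE_space
    proof eventually_elim
      case (elim x)
      have wb: "wbar w p x > 0"
        using wdev_bounds(1)[OF elim(1) p0] .
      have nonneg: "0 \<le> 32 / \<mu> ^ 4 * (Q x - q)\<^sup>2" "0 \<le> 72 * q\<^sup>2 / \<mu> ^ 6 * (wbar w p x - \<mu>)\<^sup>2"
        using mean(2) by simp_all
      show ?case
      proof (cases "x \<in> E")
        case True
        have "(wdev w p i x)\<^sup>2 \<le> (real p)\<^sup>2" if "i < p" for i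
          using power_mono[OF wdev_bounds(3)[OF elim(1) that], of 2] by simp
        then have "(\<Sum>i<p. (wdev w p i x)\<^sup>2) \<le> (\<Sum>i<p. (real p)\<^sup>2)"
          by (intro sum_mono) auto
        then have "S x \<le> (real p)\<^sup>2"
          using p0 by (simp add: S_def divide_le_eq mult.commute)
        moreover have "0 \<le> S x"
          by (simp add: S_def sum_nonneg)
        ultimately have "(S x)\<^sup>2 \<le> ((real p)\<^sup>2)\<^sup>2"
          by (intro power_mono)
        moreover have "(S x - s)\<^sup>2 \<le> 2 * (S x)\<^sup>2 + 2 * s\<^sup>2"
          using zero_le_power2[of "S x + s"] by (simp add: power2_eq_square algebra_simps)
        ultimately have "(S x - s)\<^sup>2 \<le> 2 * real p ^ 4 + 2 * s\<^sup>2"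
          by (simp flip: power_mult)
        moreover have "indicator E x = (1 :: real)"
          using True by simp
        ultimately show ?thesis
          using nonneg unfolding R_def by (simp only: mult_1_right)
      next
        case False
        then have large: "\<mu> / 2 < wbar w p x"
          using elim(2) by (simp add: E_def)
        define v where "v = 1 / wbar w p x"
        have v: "0 < v" "v \<le> 2 / \<mu>" "v * wbar w p x = 1"
          using wb large mean(2) by (simp_all add: v_def field_simps)
        have "(\<Sum>i<p. (wdev w p i x)\<^sup>2) = (\<Sum>i<p. v\<^sup>2 * (w i x)\<^sup>2 - 2 * v * w i x + 1)"
          by (intro sum.cong refl) (simp add: wdev_def v_def power2_eq_square algebra_simps)
        also have "\<dots> = v\<^sup>2 * (\<Sum>i<p. (w i x)\<^sup>2) - 2 * v * (\<Sum>i<p. w i x) + real p"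
          by (simp add: sum.distrib sum_subtractf sum_distrib_left)
        also have "\<dots> = real p * (v\<^sup>2 * Q x - 2 * (v * wbar w p x) + 1)"
          using p0 by (simp add: Q_def wbar_def field_simps)
        finally have "S x = v\<^sup>2 * Q x - 1"
          using p0 by (simp add: S_def v(3))
        \<comment> \<open>The error splits into the fluctuation of \<open>Q\<close> around
          \<open>q\<close> and that of \<open>wbar\<close> around \<open>\<mu>\<close>, each with
          mean square of order \<open>1 / p\<close>. Since \<open>v \<le> 2 / \<mu>\<close>, their
          factors are at most \<open>4 / \<mu>\<^sup>2\<close> and \<open>6 * q / \<mu> ^ 3\<close>;
          squaring and doubling gives the 32 and the 72.\<close>
        then have "S x - s = v\<^sup>2 * (Q x - q) + q * (v\<^sup>2 - 1 / \<mu>\<^sup>2)"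
          by (simp add: s_def algebra_simps)
        also have "v\<^sup>2 - 1 / \<mu>\<^sup>2 = (\<mu> - wbar w p x) * (v\<^sup>2 / \<mu> + v / \<mu>\<^sup>2)"
          using wb mean(2) by (simp add: v_def field_simps power2_eq_square)
        finally have eq: "S x - s = v\<^sup>2 * (Q x - q) + (q * (v\<^sup>2 / \<mu> + v / \<mu>\<^sup>2)) * (\<mu> - wbar w p x)"
          by (simp add: mult_ac)
        have v2: "v\<^sup>2 \<le> 4 / \<mu>\<^sup>2"
          using power_mono[OF v(2), of 2] v(1) by (simp add: power_divide)
        have "v\<^sup>2 / \<mu> + v / \<mu>\<^sup>2 \<le> (4 / \<mu>\<^sup>2) / \<mu> + (2 / \<mu>) / \<mu>\<^sup>2"
          using v2 v(2) mean(2) by (intro add_mono divide_right_mono) auto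
        also have "\<dots> = 6 / \<mu> ^ 3"
          by (simp add: power2_eq_square power3_eq_cube field_simps)
        finally have v3: "v\<^sup>2 / \<mu> + v / \<mu>\<^sup>2 \<le> 6 / \<mu> ^ 3" .
        have "(v\<^sup>2 * (Q x - q))\<^sup>2 \<le> (4 / \<mu>\<^sup>2)\<^sup>2 * (Q x - q)\<^sup>2"
          unfolding power_mult_distrib using v2 by (intro mult_right_mono power_mono) auto
        moreover have "((q * (v\<^sup>2 / \<mu> + v / \<mu>\<^sup>2)) * (\<mu> - wbar w p x))\<^sup>2 \<le> (q * (6 / \<mu> ^ 3))\<^sup>2 * (\<mu> - wbar w p x)\<^sup>2"
          unfolding power_mult_distrib[of "q * (v\<^sup>2 / \<mu> + v / \<mu>\<^sup>2)"]
          using v3 q v(1) mean(2) by (intro mult_right_mono power_mono mult_left_mono) auto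
        ultimately have "(S x - s)\<^sup>2 \<le> 2 * ((4 / \<mu>\<^sup>2)\<^sup>2 * (Q x - q)\<^sup>2) + 2 * ((q * (6 / \<mu> ^ 3))\<^sup>2 * (\<mu> - wbar w p x)\<^sup>2)"
          unfolding eq by (intro order_trans[OF power2_add_le] add_mono mult_left_mono) auto
        also have "\<dots> = 32 / \<mu> ^ 4 * (Q x - q)\<^sup>2 + 72 * q\<^sup>2 / \<mu> ^ 6 * (wbar w p x - \<mu>)\<^sup>2"
          by (simp add: power_divide power_mult_distrib power2_commute[of \<mu>] flip: power_mult)
        also have "\<dots> = R x"
          using False by (simp add: R_def)
        finally show ?thesis .
      qed
    qed
    have "integrable M (\<lambda>x. (S x - s)\<^sup>2)"
    proof (rule Bochner_Integration.integrable_bound)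
      show "integrable M R" using R by (simp add: has_bochner_integral_iff)
      show "AE x in M. norm ((S x - s)\<^sup>2) \<le> norm (R x)"
        using le by eventually_elim simp
    qed simp
    then have "expectation (\<lambda>x. (S x - s)\<^sup>2) \<le> expectation R"
      using le R by (intro integral_mono_AE) (auto simp: has_bochner_integral_iff)
    also have "\<dots> = 32 / \<mu> ^ 4 * (V2 / real p) + 72 * q\<^sup>2 / \<mu> ^ 6 * (V1 / real p)
      + (2 * real p ^ 4 + 2 * s\<^sup>2) * prob E"
      using R by (simp add: has_bochner_integral_iff)
    also have "\<dots> \<le> 32 / \<mu> ^ 4 * (V2 / real p) + 72 * q\<^sup>2 / \<mu> ^ 6 * (V1 / real p)
      + (2 * real p ^ 4 + 2 * s\<^sup>2) * \<rho> ^ p"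
      using \<rho>(3)[OF p0] by (intro add_left_mono mult_left_mono) (auto simp: E_def)
    finally have "expectation (\<lambda>x. (S x - s)\<^sup>2) \<le> \<dots>" .
    moreover have "\<nu>4 M w p / real p \<le> C / real p"
      using C[OF p0] by (intro divide_right_mono) auto
    moreover have "\<bar>\<nu>12 M w p - (\<nu>2 M w p)\<^sup>2\<bar> \<le> expectation (\<lambda>x. (S x - s)\<^sup>2) + \<nu>4 M w p / real p"
      using ex.abs_m22_minus_m2_square_le[OF p, of s]
      by (simp only: ex.m22_eq ex.m2_eq ex.m4_eq \<nu>12_def \<nu>2_def \<nu>4_def S_def)
    ultimately show ?thesis
      by linarith
  qed
  have lim: "(\<lambda>p. 32 / \<mu> ^ 4 * (V2 / real p) + 72 * q\<^sup>2 / \<mu> ^ 6 * (V1 / real p)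
      + (2 * real p ^ 4 + 2 * s\<^sup>2) * \<rho> ^ p + C / real p) \<longlonglongrightarrow> 0"
  proof -
    have inv: "(\<lambda>p. c / real p) \<longlonglongrightarrow> 0" for c :: real
      by real_asymp
    have pow: "(\<lambda>p. (2 * real p ^ 4 + 2 * s\<^sup>2) * \<rho> ^ p) \<longlonglongrightarrow> 0"
      using \<rho>(1,2) by real_asymp
    show ?thesis
      using tendsto_add[OF tendsto_add[OF tendsto_add[OF
          tendsto_mult_right_zero[OF inv[of V2], of "32 / \<mu> ^ 4"]
          tendsto_mult_right_zero[OF inv[of V1], of "72 * q\<^sup>2 / \<mu> ^ 6"]] pow] inv[of C]]
      by (simp only: add_0_right)
  qed
  show ?thesis
  proof (rule Lim_null_comparison[OF _ lim])
    show "\<forall>\<^sub>F p in sequentially. norm (\<nu>12 M w p - (\<nu>2 M w p)\<^sup>2) \<le>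
        32 / \<mu> ^ 4 * (V2 / real p) + 72 * q\<^sup>2 / \<mu> ^ 6 * (V1 / real p)
      + (2 * real p ^ 4 + 2 * s\<^sup>2) * \<rho> ^ p + C / real p"
      using eventually_ge_at_top[of 2] by eventually_elim (simp only: real_norm_def bound)
  qed
qed

end

section \<open>The covariance expansion\<close>

lemma quad_form_eq:
  assumes "A \<in> carrier_mat p p"
  shows "quad_form A (vec p v) = (\<Sum>i<p. \<Sum>j<p. A $$ (i, j) * (v i * v j))"
  using assms
  by (simp add: quad_form_def mult_mat_vec_eq scalar_prod_def lessThan_atLeast0 sum_distrib_left mult_ac)

lemma mat_tr_mult:
  fixes A B :: "'a :: comm_semiring_0 mat"
  assumes "A \<in> carrier_mat p p" "B \<in> carrier_mat p p"
  shows "mat_tr (A * B) = (\<Sum>i<p. \<Sum>j<p. A $$ (i, j) * B $$ (j, i))"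
    and "mat_tr (A * transpose_mat B) = (\<Sum>i<p. \<Sum>j<p. A $$ (i, j) * B $$ (i, j))"
  using assms by (simp_all add: mat_tr_def scalar_prod_def lessThan_atLeast0)

theorem lemma4p5:
  fixes M :: "'a measure"
    and w :: "nat \<Rightarrow> 'a \<Rightarrow> real"
    and p :: "nat \<Rightarrow> nat"
    and A B :: "nat \<Rightarrow> complex mat"
    and c K \<mu> \<sigma> :: real
  assumes "prob_space M"
    and dim_ratio: "(\<lambda>n. real (p n) / real n) \<longlonglongrightarrow> c" "c > 0"
    and indep: "prob_space.indep_vars M (\<lambda>_. borel) w UNIV"
    and ident: "\<And>i. distr M borel (w i) = distr M borel (w 0)"
    and pos: "\<And>i. AE x in M. w i x > 0"
    and mean: "(\<integral>x. w 0 x \<partial>M) = \<mu>" "\<mu> > 0"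
    and var: "(\<integral>x. (w 0 x - \<mu>)\<^sup>2 \<partial>M) = \<sigma>\<^sup>2"
    and fourth: "integrable M (\<lambda>x. \<bar>w 0 x - \<mu>\<bar> ^ 4)"
    and A: "\<And>n. A n \<in> carrier_mat (p n) (p n)" "\<And>n. spectral_norm (A n) \<le> K"
    and B: "\<And>n. B n \<in> carrier_mat (p n) (p n)" "\<And>n. spectral_norm (B n) \<le> K"
  shows "(\<lambda>n.
      (\<integral>x. (quad_form (A n) (rvec w n (p n) x) - 1 / of_nat n * of_real (\<nu>2 M w (p n)) * mat_tr (A n))
          * (quad_form (B n) (rvec w n (p n) x) - 1 / of_nat n * of_real (\<nu>2 M w (p n)) * mat_tr (B n)) \<partial>M)
      - (1 / (of_nat n)\<^sup>2 * of_real (\<nu>4 M w (p n) - 3 * \<nu>12 M w (p n))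
            * (\<Sum>i<p n. A n $$ (i, i) * B n $$ (i, i))
        + 1 / (of_nat n)\<^sup>2 * of_real (\<nu>12 M w (p n))
            * (mat_tr (A n * transpose_mat (B n)) + mat_tr (A n * B n))
        + 1 / (of_nat n)\<^sup>2 * of_real (\<nu>12 M w (p n) - (\<nu>2 M w (p n))\<^sup>2)
            * (mat_tr (A n) * mat_tr (B n))))
    \<in> o(\<lambda>n. 1 / of_nat n)"
    (is "?f \<in> _")
proof -
  interpret prob_space M by fact
  have [measurable]: "w 0 \<in> borel_measurable M"
    using indep by (simp add: indep_vars_def)
  \<comment> \<open>Write \<open>w 0\<close> as its centred version plus \<open>\<mu>\<close>, and
    apply \<open>power2_add_le\<close> twice to bound the fourth power of a sum.\<close>
  have w4: "integrable M (\<lambda>x. w 0 x ^ 4)"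
  proof (rule Bochner_Integration.integrable_bound)
    show "integrable M (\<lambda>x. 8 * \<bar>w 0 x - \<mu>\<bar> ^ 4 + 8 * \<mu> ^ 4)"
      using fourth by simp
    have "(a + b) ^ 4 \<le> 8 * a ^ 4 + 8 * b ^ 4" for a b :: real
    proof -
      have "((a + b)\<^sup>2)\<^sup>2 \<le> (2 * a\<^sup>2 + 2 * b\<^sup>2)\<^sup>2"
        by (intro power_mono power2_add_le) simp
      also have "\<dots> \<le> 2 * (2 * a\<^sup>2)\<^sup>2 + 2 * (2 * b\<^sup>2)\<^sup>2"
        by (rule power2_add_le)
      finally show ?thesis
        by (simp add: power_mult_distrib flip: power_mult)
    qed
    from this[of "w 0 _ - \<mu>" \<mu>]
    show "AE x in M. norm (w 0 x ^ 4) \<le> norm (8 * \<bar>w 0 x - \<mu>\<bar> ^ 4 + 8 * \<mu> ^ 4)"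
      by (simp add: power_even_abs)
  qed simp
  interpret iid_positive M w \<mu>
    by unfold_locales (fact indep ident pos mean w4)+
  obtain C where C: "\<And>p. 0 < p \<Longrightarrow> \<nu>4 M w p \<le> C"
    by (rule nu4_bounded) blast
  define \<Delta> where "\<Delta> p = \<nu>12 M w p - (\<nu>2 M w p)\<^sup>2" for p
  have K: "0 \<le> K"
    using spectral_norm_nonneg[OF A(1)[of 0]] A(2)[of 0] by simp
  have bound: "norm (?f n / (1 / of_nat n)) \<le> K\<^sup>2 * (696 * C) * (1 / real n) + 8 * K\<^sup>2 * (real (p n) / real n * \<bar>\<Delta> (p n)\<bar>)"
    if n: "0 < n" and p: "4 \<le> p n" for n
  proof -
    have p0: "0 < p n" using p by simp
    interpret ex: exchangeable_zero_sum M "wdev w (p n)" "p n" "real (p n)"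
      by (rule exchangeable_wdev[OF p0])
    let ?A = "\<lambda>i j. A n $$ (i, j)" and ?B = "\<lambda>i j. B n $$ (i, j)"
    define tA tB where "tA = (\<Sum>i<p n. A n $$ (i, i))" and "tB = (\<Sum>i<p n. B n $$ (i, i))"
    define N where "N = complex_of_nat n"
    have N: "N \<noteq> 0" using n by (simp add: N_def)
    have tr: "mat_tr (A n) = tA" "mat_tr (B n) = tB"
      using A(1)[of n] B(1)[of n] by (simp_all add: mat_tr_def tA_def tB_def)
    have root: "complex_of_real (sqrt (real n)) * complex_of_real (sqrt (real n)) = N"
      by (simp add: N_def flip: of_real_mult)
    \<comment> \<open>Each entry of \<open>rvec\<close> carries \<open>1 / sqrt n\<close>, so the
      form carries \<open>1 / n\<close>.\<close>
    have qf: "quad_form D (rvec w n (p n) x) = ex.qform (\<lambda>i j. D $$ (i, j)) x / N"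
      if D: "D \<in> carrier_mat (p n) (p n)" for D x
      unfolding rvec_def quad_form_eq[OF D] ex.qform_def sum_divide_distrib root[symmetric]
      by (intro sum.cong refl) simp
    define m2 where "m2 = \<nu>2 M w (p n)"
    define m4 where "m4 = \<nu>4 M w (p n)"
    define m22 where "m22 = \<nu>12 M w (p n)"
    define I where "I = (\<integral>x. (ex.qform ?A x - of_real m2 * tA) * (ex.qform ?B x - of_real m2 * tB) \<partial>M)"
    define G where "G = of_real (m4 - 3 * m22) * (\<Sum>i<p n. A n $$ (i, i) * B n $$ (i, i))
        + of_real m22 * (mat_tr (A n * transpose_mat (B n)) + mat_tr (A n * B n))
        + of_real (m22 - m2\<^sup>2) * (tA * tB)"
    have "(ex.qform ?A x / N - 1 / N * of_real m2 * tA) * (ex.qform ?B x / N - 1 / N * of_real m2 * tB)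
        = 1 / N\<^sup>2 * ((ex.qform ?A x - of_real m2 * tA) * (ex.qform ?B x - of_real m2 * tB))" for x
      by (simp add: power2_eq_square algebra_simps add_divide_distrib diff_divide_distrib)
    then have "(\<integral>x. (ex.qform ?A x / N - 1 / N * of_real m2 * tA) * (ex.qform ?B x / N - 1 / N * of_real m2 * tB) \<partial>M)
        = 1 / N\<^sup>2 * I"
      unfolding I_def by (simp only: integral_mult_right_zero)
    then have "?f n = 1 / N\<^sup>2 * I - 1 / N\<^sup>2 * G"
      unfolding qf[OF A(1)] qf[OF B(1)] tr N_def[symmetric] m2_def[symmetric] m4_def[symmetric] m22_def[symmetric] G_def
      by (simp only: distrib_left mult.assoc)
    \<comment> \<open>Dividing by the comparison function \<open>1 / n\<close> leaves a single
      factor \<open>1 / n\<close> in front of the unscaled covariance error.\<close>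
    then have f: "?f n / (1 / N) = (I - G) / N"
      using N by (simp only:) (simp add: field_simps power2_eq_square)
    have "cmod (I - G) \<le> K\<^sup>2 * (696 * m4 + 8 * real (p n) * \<bar>\<Delta> (p n)\<bar>)"
      using ex.quadratic_form_covariance[OF p K l2_bounded_spectral_norm[OF A] l2_bounded_spectral_norm[OF B]]
      by (simp add: I_def G_def \<Delta>_def mat_tr_mult[OF A(1) B(1)] ex.m2_eq ex.m4_eq ex.m22_eq tA_def tB_def
         m2_def m4_def m22_def \<nu>2_def \<nu>4_def \<nu>12_def)
    also have "\<dots> \<le> K\<^sup>2 * (696 * C + 8 * real (p n) * \<bar>\<Delta> (p n)\<bar>)"
      using C[OF p0] by (intro mult_left_mono add_right_mono) (auto simp: m4_def)
    finally have "cmod (I - G) / real n \<le> K\<^sup>2 * (696 * C + 8 * real (p n) * \<bar>\<Delta> (p n)\<bar>) / real n"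
      by (intro divide_right_mono) auto
    also have "\<dots> = K\<^sup>2 * (696 * C) * (1 / real n) + 8 * K\<^sup>2 * (real (p n) / real n * \<bar>\<Delta> (p n)\<bar>)"
      by (simp add: algebra_simps add_divide_distrib)
    finally show ?thesis
      by (simp only: f[unfolded N_def] norm_divide[of "I - G"] norm_of_nat)
  qed
  \<comment> \<open>Since \<open>p / n\<close> has the positive limit \<open>c\<close>, the product
    \<open>(p / n) * n\<close> tends to infinity; thus \<open>p n\<close> does, and the limits in
    \<open>p\<close> can be composed with it.\<close>
  have "LIM n sequentially. real (p n) / real n * real n :> at_top"
    by (rule filterlim_tendsto_pos_mult_at_top[OF dim_ratio filterlim_real_sequentially])
  moreover have "\<forall>\<^sub>F n in sequentially. real (p n) / real n * real n = real (p n)"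
    using eventually_gt_at_top[of 0] by eventually_elim simp
  ultimately have "LIM n sequentially. real (p n) :> at_top"
    by (simp add: filterlim_cong)
  then have p_top: "filterlim p at_top sequentially"
    by (simp add: filterlim_sequentially_iff_filterlim_real)
  have "(\<lambda>n. \<bar>\<Delta> (p n)\<bar>) \<longlonglongrightarrow> 0"
    using filterlim_compose[OF nu12_minus_nu2_square p_top] unfolding \<Delta>_def by (rule tendsto_rabs_zero)
  \<comment> \<open>The convergence of \<open>p / n\<close> absorbs the factor \<open>p\<close> that
    the covariance bound puts in front of \<open>\<Delta>\<close>.\<close>
  from tendsto_mult[OF dim_ratio(1) this]
  have "(\<lambda>n. 8 * K\<^sup>2 * (real (p n) / real n * \<bar>\<Delta> (p n)\<bar>)) \<longlonglongrightarrow> 0"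
    by (intro tendsto_mult_right_zero) simp
  moreover have "(\<lambda>n. K\<^sup>2 * (696 * C) * (1 / real n)) \<longlonglongrightarrow> 0"
    by (intro tendsto_mult_right_zero lim_1_over_n)
  ultimately have lim: "(\<lambda>n. K\<^sup>2 * (696 * C) * (1 / real n) + 8 * K\<^sup>2 * (real (p n) / real n * \<bar>\<Delta> (p n)\<bar>)) \<longlonglongrightarrow> 0"
    using tendsto_add_zero by blast
  show ?thesis
  proof (rule smalloI_tendsto)
    have "\<forall>\<^sub>F n in sequentially. 4 \<le> p n"
      using p_top by (simp add: filterlim_at_top)
    then have "\<forall>\<^sub>F n in sequentially. norm (?f n / (1 / of_nat n)) \<le>
        K\<^sup>2 * (696 * C) * (1 / real n) + 8 * K\<^sup>2 * (real (p n) / real n * \<bar>\<Delta> (p n)\<bar>)"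
      using eventually_gt_at_top[of 0] by eventually_elim (rule bound)
    then show "(\<lambda>n. ?f n / (1 / of_nat n)) \<longlonglongrightarrow> 0"
      by (rule Lim_null_comparison[OF _ lim])
    show "\<forall>\<^sub>F n in sequentially. 1 / of_nat n \<noteq> (0 :: complex)"
      using eventually_gt_at_top[of 0] by eventually_elim simp
  qed
qed

end
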